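(* Let $(-)^\ddagger$ be the translation from $\mathrm W$ to $\mathrm T+\mathit{min}$ which replaces each occurrence of $\mathit{while}_\sigma$ by the $\mathrm T+\mathit{min}$ program $$\mathit{While}'_\sigma=\lambda cxf.\ \mathit{rec}_\sigma\;x\;(\lambda x'n.\,fx')\;\big(\mathit{min}\;(\lambda n.\;c\,(\mathit{rec}_\sigma\;x\;(\lambda x'n'.\,fx')\;n)\neq\widehat 0)\;\widehat 0\big),$$ and let $(-)^\circ$ be the translation from $\mathrm W$ and $\mathrm T+\mathit{min}$ into $\mathrm{PCF}+\mathit{byval}$ which replaces $\mathit{while}_\sigma,\mathit{rec}_\sigma,\mathit{min}$ by $\mathit{While}_\sigma,\mathit{Rec}_\sigma,\mathit{Min}$. Then: (i) $(\mathit{While}'_\sigma)^\circ\simeq_{\mathrm{obs}}\mathit{While}_\sigma$ for every type $\sigma$. (ii) For any closed term $M$ of $\mathrm W$, $(M^\ddagger)^\circ\simeq_{\mathrm{obs}}M^\circ$. (iii) For any closed $M:\mathtt N$ of $\mathrm W$ and any $n\in\mathbb N$, $M\rightsquigarrow^*\widehat n$ iff $M^\ddagger\rightsquigarrow^*\widehat n$.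
   Context: **Types** are $\sigma,\tau::=\mathtt N\mid\sigma\to\tau\mid\sigma\times\tau$. The base language $\mathrm B$ is the simply typed $\lambda$-calculus with pairing $\langle M,N\rangle$ and projections $\mathit{fst},\mathit{snd}$, over constants $\widehat n:\mathtt N$ ($n\in\mathbb N$), $\mathit{suc},\mathit{pre}:\mathtt N\to\mathtt N$, $\mathit{ifzero}:\mathtt N\to\mathtt N\to\mathtt N\to\mathtt N$. The operation $\mathit{ifzero}_\sigma:\mathtt N\to\sigma\to\sigma\to\sigma$ abbreviates the evident $\mathrm B$ term: $\mathit{ifzero}_{\mathtt N}=\mathit{ifzero}$, $\mathit{ifzero}_{\sigma\to\tau}=\lambda nxyz.\,\mathit{ifzero}_\tau\,n\,(xz)\,(yz)$, $\mathit{ifzero}_{\sigma\times\tau}=\lambda nxy.\langle\mathit{ifzero}_\sigma\,n(\mathit{fst}\,x)(\mathit{fst}\,y),\mathit{ifzero}_\tau\,n(\mathit{snd}\,x)(\mathit{snd}\,y)\rangle$. **Additional constants:** $Y_\sigma:(\sigma\to\sigma)\to\sigma$; $\mathit{while}_\sigma:(\sigma\to\mathtt N)\to\sigma\to(\sigma\to\sigma)\to\sigma$; $\mathit{rec}_\sigma:\sigma\to(\sigma\to\mathtt N\to\sigma)\to\mathtt N\to\sigma$; $\mathit{min}:(\mathtt N\to\mathtt N)\to\mathtt N\to\mathtt N$; $\mathit{byval}^{\vec\sigma}_\tau:(\vec\sigma\to\mathtt N\to\tau)\to(\vec\sigma\to\mathtt N\to\tau)$ ($\epsilon$ denotes the empty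 list of types). $\mathrm{PCF}+\mathit{byval}$ is $\mathrm B$ plus all $Y_\sigma$ and $\mathit{byval}^{\vec\sigma}_\tau$; $\mathrm W$ is $\mathrm B$ plus all $\mathit{while}_\sigma$; $\mathrm T+\mathit{min}$ is $\mathrm B$ plus all $\mathit{rec}_\sigma$ and $\mathit{min}$. **Reduction** (call-by-name, deterministic): $\mathit{fst}\langle M,N\rangle\rightsquigarrow M$; $\mathit{snd}\langle M,N\rangle\rightsquigarrow N$; $(\lambda x.M)N\rightsquigarrow M[x\mapsto N]$; $\mathit{suc}\,\widehat n\rightsquigarrow\widehat{n+1}$; $\mathit{pre}\,\widehat{n+1}\rightsquigarrow\widehat n$; $\mathit{pre}\,\widehat0\rightsquigarrow\widehat0$; $\mathit{ifzero}\,\widehat0\rightsquigarrow\lambda xy.x$; $\mathit{ifzero}\,\widehat{n+1}\rightsquigarrow\lambda xy.y$; $Y_\sigma F\rightsquigarrow F(Y_\sigma F)$; $\mathit{while}_\sigma CXF\rightsquigarrow\mathit{ifzero}_\sigma(CX)(\mathit{while}_\sigma C(FX)F)X$; $\mathit{rec}_\sigma XF\widehat0\rightsquigarrow X$; $\mathit{rec}_\sigma XF\widehat{n+1}\rightsquigarrow F(\mathit{rec}_\sigma XF\widehat n)\widehat n$; $\mathit{min}\,F\,\widehat n\rightsquigarrow\mathit{ifzero}(F\widehat n)\widehat n(\mathit{min}\,F(\mathit{suc}\,\widehat n))$; $\mathit{byval}^{\vec\sigma}_\tau F\vec X\widehat n\rightsquigarrow F\vec X\widehat n$ (with $|\vec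 X|=|\vec\sigma|$); and if $M\rightsquigarrow M'$ then $E[M]\rightsquigarrow E[M']$ for $E[-]$ one of $[-]N$, $\mathit{suc}[-]$, $\mathit{pre}[-]$, $\mathit{ifzero}[-]$, $\mathit{fst}[-]$, $\mathit{snd}[-]$, $\mathit{rec}_\sigma XF[-]$, $\mathit{min}\,F[-]$, $\mathit{byval}^{\vec\sigma}_\tau F\vec X[-]$. A closed term of type $\mathtt N$ diverges if it does not reduce to a numeral. **Observational equivalence.** For closed $\mathrm{PCF}+\mathit{byval}$ terms $M,M':\sigma$, $M\simeq_{\mathrm{obs}}M'$ iff for every $\mathrm{PCF}+\mathit{byval}$ context $C[-]:\mathtt N$ with a hole of type $\sigma$ and every $n$: $C[M]\rightsquigarrow^*\widehat n$ iff $C[M']\rightsquigarrow^*\widehat n$. **Programs used by $(-)^\circ$.** With $\rho,\mu$ the types of $\mathit{rec}_\sigma,\mathit{min}$ and $\mathit{byval}^+_\sigma=\mathit{byval}^{\sigma,(\sigma\to\mathtt N\to\sigma)}_\sigma$: $\mathit{While}_\sigma=\lambda cxf.\,Y_{\sigma\to\sigma}(\lambda w.\lambda x'.\,\mathit{ifzero}_\sigma(cx')(w(fx'))x')\,x$; $\mathit{Rec}_\sigma=\mathit{byval}^+_\sigma(Y_\rho(\lambda r.\lambda xfn.\,\mathit{ifzero}_\sigma\,n\,x\,(\mathit{byval}^\epsilon_\sigma(\lambda n'.f((\mathit{byval}^+_\sigma r)xfn')n')(\mathit{pre}\,n))))$; $\mathit{Min}=\mathit{byval}^{\mathtt N\to\mathtt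 N}_{\mathtt N}(Y_\mu(\lambda m.\lambda fn.\,\mathit{ifzero}(fn)\,n\,((\mathit{byval}^{\mathtt N\to\mathtt N}_{\mathtt N}m)f(\mathit{suc}\,n))))$. **Inequality.** $\neq$ (written infix) is a fixed closed $\mathrm T+\mathit{min}$ program of type $\mathtt N\to\mathtt N\to\mathtt N$ implementing inequality testing, with $0$ as "true": for closed $M,N:\mathtt N$ evaluating to $\widehat m,\widehat n$, $M\neq N$ evaluates to $\widehat0$ if $m\ne n$ and to a nonzero numeral if $m=n$; it diverges if $M$ or $N$ does (this holding also for $(\neq)^\circ$ on closed $\mathrm{PCF}+\mathit{byval}$ terms). *)

theory Defs
  imports Main
begin

section \<open>Types and terms\<close>

datatype ty = N | Fun ty ty (infixr "\<rightarrow>" 65) | Prod ty ty (infixr "\<otimes>" 70)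

datatype cnst =
    CNum nat | CSuc | CPre | CIfzero
  | CY ty | CWhile ty | CRec ty | CMin | CByval "ty list" ty

text \<open>
  De Bruijn terms with type-annotated abstractions. All the languages share this one term type and
  one reduction relation; a language is given by the set of constants it may use.
\<close>

datatype tm =
    Var nat
  | Const cnst
  | Lam ty tm
  | App tm tm (infixl "\<cdot>" 90)
  | Pair tm tm
  | Fst tm
  | Snd tm

abbreviation num :: "nat \<Rightarrow> tm" where "num n \<equiv> Const (CNum n)"

abbreviation apps :: "tm \<Rightarrow> tm list \<Rightarrow> tm" where "apps F Xs \<equiv> foldl App F Xs"

abbreviation funs :: "ty list \<Rightarrow> ty \<Rightarrow> ty" where "funs \<sigma>s \<tau> \<equiv> foldr Fun \<sigma>s \<tau>"

abbreviation while_ty :: "ty \<Rightarrow> ty" where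
  "while_ty \<sigma> \<equiv> (\<sigma> \<rightarrow> N) \<rightarrow> \<sigma> \<rightarrow> (\<sigma> \<rightarrow> \<sigma>) \<rightarrow> \<sigma>"

abbreviation rec_ty :: "ty \<Rightarrow> ty" where
  "rec_ty \<sigma> \<equiv> \<sigma> \<rightarrow> (\<sigma> \<rightarrow> N \<rightarrow> \<sigma>) \<rightarrow> N \<rightarrow> \<sigma>"

abbreviation min_ty :: ty where
  "min_ty \<equiv> (N \<rightarrow> N) \<rightarrow> N \<rightarrow> N"

primrec cnst_ty :: "cnst \<Rightarrow> ty" where
  "cnst_ty (CNum n) = N"
| "cnst_ty CSuc = N \<rightarrow> N"
| "cnst_ty CPre = N \<rightarrow> N"
| "cnst_ty CIfzero = N \<rightarrow> N \<rightarrow> N \<rightarrow> N"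
| "cnst_ty (CY \<sigma>) = (\<sigma> \<rightarrow> \<sigma>) \<rightarrow> \<sigma>"
| "cnst_ty (CWhile \<sigma>) = while_ty \<sigma>"
| "cnst_ty (CRec \<sigma>) = rec_ty \<sigma>"
| "cnst_ty CMin = min_ty"
| "cnst_ty (CByval \<sigma>s \<tau>) = funs \<sigma>s (N \<rightarrow> \<tau>) \<rightarrow> funs \<sigma>s (N \<rightarrow> \<tau>)"

inductive typing :: "ty list \<Rightarrow> tm \<Rightarrow> ty \<Rightarrow> bool" ("_ \<turnstile> _ : _" [50, 50, 50] 50) where
  "i < length \<Gamma> \<Longrightarrow> \<Gamma> \<turnstile> Var i : \<Gamma> ! i"
| "\<Gamma> \<turnstile> Const c : cnst_ty c"
| "\<sigma> # \<Gamma> \<turnstile> M : \<tau> \<Longrightarrow> \<Gamma> \<turnstile> Lam \<sigma> M : \<sigma> \<rightarrow> \<tau>"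
| "\<Gamma> \<turnstile> M : \<sigma> \<rightarrow> \<tau> \<Longrightarrow> \<Gamma> \<turnstile> P : \<sigma> \<Longrightarrow> \<Gamma> \<turnstile> M \<cdot> P : \<tau>"
| "\<Gamma> \<turnstile> M : \<sigma> \<Longrightarrow> \<Gamma> \<turnstile> P : \<tau> \<Longrightarrow> \<Gamma> \<turnstile> Pair M P : \<sigma> \<otimes> \<tau>"
| "\<Gamma> \<turnstile> M : \<sigma> \<otimes> \<tau> \<Longrightarrow> \<Gamma> \<turnstile> Fst M : \<sigma>"
| "\<Gamma> \<turnstile> M : \<sigma> \<otimes> \<tau> \<Longrightarrow> \<Gamma> \<turnstile> Snd M : \<tau>"

primrec cnsts_of :: "tm \<Rightarrow> cnst set" where
  "cnsts_of (Var i) = {}"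
| "cnsts_of (Const c) = {c}"
| "cnsts_of (Lam \<sigma> M) = cnsts_of M"
| "cnsts_of (M \<cdot> P) = cnsts_of M \<union> cnsts_of P"
| "cnsts_of (Pair M P) = cnsts_of M \<union> cnsts_of P"
| "cnsts_of (Fst M) = cnsts_of M"
| "cnsts_of (Snd M) = cnsts_of M"

definition lang_B :: "cnst set" where
  "lang_B = range CNum \<union> {CSuc, CPre, CIfzero}"

definition lang_PCF_byval :: "cnst set" where
  "lang_PCF_byval = lang_B \<union> range CY \<union> {CByval \<sigma>s \<tau> |\<sigma>s \<tau>. True}"

definition lang_W :: "cnst set" where
  "lang_W = lang_B \<union> range CWhile"

definition lang_T_min :: "cnst set" where
  "lang_T_min = lang_B \<union> range CRec \<union> {CMin}"

definition closed_term :: "cnst set \<Rightarrow> tm \<Rightarrow> ty \<Rightarrow> bool" where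
  "closed_term L M \<sigma> \<longleftrightarrow> cnsts_of M \<subseteq> L \<and> [] \<turnstile> M : \<sigma>"

section \<open>Reduction\<close>

primrec lift :: "tm \<Rightarrow> nat \<Rightarrow> tm" where
  "lift (Var i) k = (if i < k then Var i else Var (Suc i))"
| "lift (Const c) k = Const c"
| "lift (Lam \<sigma> M) k = Lam \<sigma> (lift M (Suc k))"
| "lift (M \<cdot> P) k = lift M k \<cdot> lift P k"
| "lift (Pair M P) k = Pair (lift M k) (lift P k)"
| "lift (Fst M) k = Fst (lift M k)"
| "lift (Snd M) k = Snd (lift M k)"

text \<open>\<open>subst M S k\<close> also decrements the indices above \<open>k\<close>, as needed for beta reduction.\<close>

primrec subst :: "tm \<Rightarrow> tm \<Rightarrow> nat \<Rightarrow> tm" where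
  "subst (Var i) S k = (if i < k then Var i else if i = k then S else Var (i - 1))"
| "subst (Const c) S k = Const c"
| "subst (Lam \<sigma> M) S k = Lam \<sigma> (subst M (lift S 0) (Suc k))"
| "subst (M \<cdot> P) S k = subst M S k \<cdot> subst P S k"
| "subst (Pair M P) S k = Pair (subst M S k) (subst P S k)"
| "subst (Fst M) S k = Fst (subst M S k)"
| "subst (Snd M) S k = Snd (subst M S k)"

text \<open>
  In named notation:
  \<open>\<lambda>n x y z. ifzero_\<tau> n (x z) (y z)\<close> at \<open>\<sigma> \<rightarrow> \<tau>\<close>, and
  \<open>\<lambda>n x y. (ifzero_\<sigma> n (fst x) (fst y), ifzero_\<tau> n (snd x) (snd y))\<close> at \<open>\<sigma> \<otimes> \<tau>\<close>.
  Here and below, closed terms are used under binders without lifting.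
\<close>

primrec ifzero :: "ty \<Rightarrow> tm" where
  "ifzero N = Const CIfzero"
| "ifzero (\<sigma> \<rightarrow> \<tau>) =
     Lam N (Lam (\<sigma> \<rightarrow> \<tau>) (Lam (\<sigma> \<rightarrow> \<tau>) (Lam \<sigma>
       (ifzero \<tau> \<cdot> Var 3 \<cdot> (Var 2 \<cdot> Var 0) \<cdot> (Var 1 \<cdot> Var 0)))))"
| "ifzero (\<sigma> \<otimes> \<tau>) =
     Lam N (Lam (\<sigma> \<otimes> \<tau>) (Lam (\<sigma> \<otimes> \<tau>)
       (Pair (ifzero \<sigma> \<cdot> Var 2 \<cdot> Fst (Var 1) \<cdot> Fst (Var 0))
             (ifzero \<tau> \<cdot> Var 2 \<cdot> Snd (Var 1) \<cdot> Snd (Var 0)))))"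

inductive step :: "tm \<Rightarrow> tm \<Rightarrow> bool" (infix "\<leadsto>" 50) where
  "Fst (Pair M P) \<leadsto> M"
| "Snd (Pair M P) \<leadsto> P"
| "Lam \<sigma> M \<cdot> P \<leadsto> subst M P 0"
| "Const CSuc \<cdot> num n \<leadsto> num (Suc n)"
| "Const CPre \<cdot> num (Suc n) \<leadsto> num n"
| "Const CPre \<cdot> num 0 \<leadsto> num 0"
| "Const CIfzero \<cdot> num 0 \<leadsto> Lam N (Lam N (Var 1))"
| "Const CIfzero \<cdot> num (Suc n) \<leadsto> Lam N (Lam N (Var 0))"
| "Const (CY \<sigma>) \<cdot> F \<leadsto> F \<cdot> (Const (CY \<sigma>) \<cdot> F)"
| "Const (CWhile \<sigma>) \<cdot> C \<cdot> X \<cdot> F \<leadsto>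
     ifzero \<sigma> \<cdot> (C \<cdot> X) \<cdot> (Const (CWhile \<sigma>) \<cdot> C \<cdot> (F \<cdot> X) \<cdot> F) \<cdot> X"
| "Const (CRec \<sigma>) \<cdot> X \<cdot> F \<cdot> num 0 \<leadsto> X"
| "Const (CRec \<sigma>) \<cdot> X \<cdot> F \<cdot> num (Suc n) \<leadsto> F \<cdot> (Const (CRec \<sigma>) \<cdot> X \<cdot> F \<cdot> num n) \<cdot> num n"
| "Const CMin \<cdot> F \<cdot> num n \<leadsto>
     Const CIfzero \<cdot> (F \<cdot> num n) \<cdot> num n \<cdot> (Const CMin \<cdot> F \<cdot> (Const CSuc \<cdot> num n))"
| "length Xs = length \<sigma>s \<Longrightarrow>
     apps (Const (CByval \<sigma>s \<tau>) \<cdot> F) Xs \<cdot> num n \<leadsto> apps F Xs \<cdot> num n"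
| "M \<leadsto> M' \<Longrightarrow> M \<cdot> P \<leadsto> M' \<cdot> P"
| "M \<leadsto> M' \<Longrightarrow> Const CSuc \<cdot> M \<leadsto> Const CSuc \<cdot> M'"
| "M \<leadsto> M' \<Longrightarrow> Const CPre \<cdot> M \<leadsto> Const CPre \<cdot> M'"
| "M \<leadsto> M' \<Longrightarrow> Const CIfzero \<cdot> M \<leadsto> Const CIfzero \<cdot> M'"
| "M \<leadsto> M' \<Longrightarrow> Fst M \<leadsto> Fst M'"
| "M \<leadsto> M' \<Longrightarrow> Snd M \<leadsto> Snd M'"
| "M \<leadsto> M' \<Longrightarrow> Const (CRec \<sigma>) \<cdot> X \<cdot> F \<cdot> M \<leadsto> Const (CRec \<sigma>) \<cdot> X \<cdot> F \<cdot> M'"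
| "M \<leadsto> M' \<Longrightarrow> Const CMin \<cdot> F \<cdot> M \<leadsto> Const CMin \<cdot> F \<cdot> M'"
| "M \<leadsto> M' \<Longrightarrow> length Xs = length \<sigma>s \<Longrightarrow>
     apps (Const (CByval \<sigma>s \<tau>) \<cdot> F) Xs \<cdot> M \<leadsto> apps (Const (CByval \<sigma>s \<tau>) \<cdot> F) Xs \<cdot> M'"

abbreviation steps :: "tm \<Rightarrow> tm \<Rightarrow> bool" (infix "\<leadsto>\<^sup>*" 50) where
  "M \<leadsto>\<^sup>* M' \<equiv> step\<^sup>*\<^sup>* M M'"

definition diverges :: "tm \<Rightarrow> bool" where
  "diverges M \<longleftrightarrow> \<not> (\<exists>n. M \<leadsto>\<^sup>* num n)"

section \<open>Observational equivalence\<close>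

datatype ctx =
    Hole
  | CLam ty ctx
  | CAppL ctx tm
  | CAppR tm ctx
  | CPairL ctx tm
  | CPairR tm ctx
  | CFst ctx
  | CSnd ctx

text \<open>
  Contexts are only ever filled with closed terms, so no lifting is needed under \<open>CLam\<close>.
\<close>

primrec fill :: "ctx \<Rightarrow> tm \<Rightarrow> tm" where
  "fill Hole M = M"
| "fill (CLam \<sigma> C) M = Lam \<sigma> (fill C M)"
| "fill (CAppL C P) M = fill C M \<cdot> P"
| "fill (CAppR P C) M = P \<cdot> fill C M"
| "fill (CPairL C P) M = Pair (fill C M) P"
| "fill (CPairR P C) M = Pair P (fill C M)"
| "fill (CFst C) M = Fst (fill C M)"
| "fill (CSnd C) M = Snd (fill C M)"

primrec ctx_cnsts_of :: "ctx \<Rightarrow> cnst set" where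
  "ctx_cnsts_of Hole = {}"
| "ctx_cnsts_of (CLam \<sigma> C) = ctx_cnsts_of C"
| "ctx_cnsts_of (CAppL C P) = ctx_cnsts_of C \<union> cnsts_of P"
| "ctx_cnsts_of (CAppR P C) = cnsts_of P \<union> ctx_cnsts_of C"
| "ctx_cnsts_of (CPairL C P) = ctx_cnsts_of C \<union> cnsts_of P"
| "ctx_cnsts_of (CPairR P C) = cnsts_of P \<union> ctx_cnsts_of C"
| "ctx_cnsts_of (CFst C) = ctx_cnsts_of C"
| "ctx_cnsts_of (CSnd C) = ctx_cnsts_of C"

text \<open>\<open>ctx_typing \<kappa> \<Gamma> C \<sigma>\<close>: in \<open>\<Gamma>\<close>, the context \<open>C\<close> with a hole of type \<open>\<kappa>\<close> has type \<open>\<sigma>\<close>.\<close>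

inductive ctx_typing :: "ty \<Rightarrow> ty list \<Rightarrow> ctx \<Rightarrow> ty \<Rightarrow> bool" for \<kappa> where
  "ctx_typing \<kappa> \<Gamma> Hole \<kappa>"
| "ctx_typing \<kappa> (\<sigma> # \<Gamma>) C \<tau> \<Longrightarrow> ctx_typing \<kappa> \<Gamma> (CLam \<sigma> C) (\<sigma> \<rightarrow> \<tau>)"
| "ctx_typing \<kappa> \<Gamma> C (\<sigma> \<rightarrow> \<tau>) \<Longrightarrow> \<Gamma> \<turnstile> P : \<sigma> \<Longrightarrow> ctx_typing \<kappa> \<Gamma> (CAppL C P) \<tau>"
| "\<Gamma> \<turnstile> P : \<sigma> \<rightarrow> \<tau> \<Longrightarrow> ctx_typing \<kappa> \<Gamma> C \<sigma> \<Longrightarrow> ctx_typing \<kappa> \<Gamma> (CAppR P C) \<tau>"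
| "ctx_typing \<kappa> \<Gamma> C \<sigma> \<Longrightarrow> \<Gamma> \<turnstile> P : \<tau> \<Longrightarrow> ctx_typing \<kappa> \<Gamma> (CPairL C P) (\<sigma> \<otimes> \<tau>)"
| "\<Gamma> \<turnstile> P : \<sigma> \<Longrightarrow> ctx_typing \<kappa> \<Gamma> C \<tau> \<Longrightarrow> ctx_typing \<kappa> \<Gamma> (CPairR P C) (\<sigma> \<otimes> \<tau>)"
| "ctx_typing \<kappa> \<Gamma> C (\<sigma> \<otimes> \<tau>) \<Longrightarrow> ctx_typing \<kappa> \<Gamma> (CFst C) \<sigma>"
| "ctx_typing \<kappa> \<Gamma> C (\<sigma> \<otimes> \<tau>) \<Longrightarrow> ctx_typing \<kappa> \<Gamma> (CSnd C) \<tau>"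

definition obs_eq :: "ty \<Rightarrow> tm \<Rightarrow> tm \<Rightarrow> bool" where
  "obs_eq \<sigma> M M' \<longleftrightarrow>
     closed_term lang_PCF_byval M \<sigma> \<and> closed_term lang_PCF_byval M' \<sigma> \<and>
     (\<forall>C n. ctx_cnsts_of C \<subseteq> lang_PCF_byval \<and> ctx_typing \<sigma> [] C N \<longrightarrow>
        (fill C M \<leadsto>\<^sup>* num n \<longleftrightarrow> fill C M' \<leadsto>\<^sup>* num n))"

section \<open>The translations\<close>

primrec replace :: "(cnst \<Rightarrow> tm) \<Rightarrow> tm \<Rightarrow> tm" where
  "replace h (Var i) = Var i"
| "replace h (Const c) = h c"
| "replace h (Lam \<sigma> M) = Lam \<sigma> (replace h M)"
| "replace h (M \<cdot> P) = replace h M \<cdot> replace h P"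
| "replace h (Pair M P) = Pair (replace h M) (replace h P)"
| "replace h (Fst M) = Fst (replace h M)"
| "replace h (Snd M) = Snd (replace h M)"

text \<open>\<open>\<lambda>c x f. Y (\<lambda>w x'. ifzero_\<sigma> (c x') (w (f x')) x') x\<close>\<close>

definition While_PCF :: "ty \<Rightarrow> tm" where
  "While_PCF \<sigma> =
     Lam (\<sigma> \<rightarrow> N) (Lam \<sigma> (Lam (\<sigma> \<rightarrow> \<sigma>)
       (Const (CY (\<sigma> \<rightarrow> \<sigma>)) \<cdot>
          Lam (\<sigma> \<rightarrow> \<sigma>) (Lam \<sigma>
            (ifzero \<sigma> \<cdot> (Var 4 \<cdot> Var 0) \<cdot> (Var 1 \<cdot> (Var 2 \<cdot> Var 0)) \<cdot> Var 0)) \<cdot>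
        Var 1)))"

abbreviation byval_plus :: "ty \<Rightarrow> tm" where
  "byval_plus \<sigma> \<equiv> Const (CByval [\<sigma>, \<sigma> \<rightarrow> N \<rightarrow> \<sigma>] \<sigma>)"

text \<open>
  \<open>byval_plus (Y (\<lambda>r x f n. ifzero_\<sigma> n x (byval (\<lambda>n'. f (byval_plus r x f n') n') (pre n))))\<close>
\<close>

definition Rec_PCF :: "ty \<Rightarrow> tm" where
  "Rec_PCF \<sigma> =
     byval_plus \<sigma> \<cdot> (Const (CY (rec_ty \<sigma>)) \<cdot>
       Lam (rec_ty \<sigma>) (Lam \<sigma> (Lam (\<sigma> \<rightarrow> N \<rightarrow> \<sigma>) (Lam N
         (ifzero \<sigma> \<cdot> Var 0 \<cdot> Var 2 \<cdot>
           (Const (CByval [] \<sigma>) \<cdot>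
              Lam N (Var 2 \<cdot> (byval_plus \<sigma> \<cdot> Var 4 \<cdot> Var 3 \<cdot> Var 2 \<cdot> Var 0) \<cdot> Var 0) \<cdot>
            (Const CPre \<cdot> Var 0)))))))"

text \<open>\<open>byval (Y (\<lambda>m f n. ifzero (f n) n (byval m f (suc n))))\<close>\<close>

definition Min_PCF :: tm where
  "Min_PCF =
     Const (CByval [N \<rightarrow> N] N) \<cdot> (Const (CY min_ty) \<cdot>
       Lam min_ty (Lam (N \<rightarrow> N) (Lam N
         (Const CIfzero \<cdot> (Var 1 \<cdot> Var 0) \<cdot> Var 0 \<cdot>
           (Const (CByval [N \<rightarrow> N] N) \<cdot> Var 2 \<cdot> Var 1 \<cdot> (Const CSuc \<cdot> Var 0))))))"

text \<open>The translation \<open>(-)\<^sup>\<circ>\<close>.\<close>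

definition to_PCF :: "tm \<Rightarrow> tm" where
  "to_PCF = replace (\<lambda>c. case c of
     CWhile \<sigma> \<Rightarrow> While_PCF \<sigma>
   | CRec \<sigma> \<Rightarrow> Rec_PCF \<sigma>
   | CMin \<Rightarrow> Min_PCF
   | _ \<Rightarrow> Const c)"

text \<open>
  For a closed program \<open>neq\<close> (inequality testing, written infix here):
  \<open>\<lambda>c x f. rec_\<sigma> x (\<lambda>x' n. f x') (min (\<lambda>n. c (rec_\<sigma> x (\<lambda>x' n'. f x') n) \<noteq> 0) 0)\<close>
\<close>

definition While_T_min :: "tm \<Rightarrow> ty \<Rightarrow> tm" where
  "While_T_min neq \<sigma> =
     Lam (\<sigma> \<rightarrow> N) (Lam \<sigma> (Lam (\<sigma> \<rightarrow> \<sigma>)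
       (Const (CRec \<sigma>) \<cdot> Var 1 \<cdot> Lam \<sigma> (Lam N (Var 2 \<cdot> Var 1)) \<cdot>
         (Const CMin \<cdot>
            Lam N (neq \<cdot>
              (Var 3 \<cdot> (Const (CRec \<sigma>) \<cdot> Var 2 \<cdot> Lam \<sigma> (Lam N (Var 3 \<cdot> Var 1)) \<cdot> Var 0)) \<cdot>
              num 0) \<cdot>
          num 0))))"

text \<open>The translation \<open>(-)\<^sup>\<ddagger>\<close>.\<close>

definition to_T_min :: "tm \<Rightarrow> tm \<Rightarrow> tm" where
  "to_T_min neq = replace (\<lambda>c. case c of
     CWhile \<sigma> \<Rightarrow> While_T_min neq \<sigma>
   | _ \<Rightarrow> Const c)"

text \<open>Inequality testing with 0 as truth value \<open>true\<close>, strict in both arguments.\<close>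

definition implements_neq :: "cnst set \<Rightarrow> tm \<Rightarrow> bool" where
  "implements_neq L neq \<longleftrightarrow>
     (\<forall>M P. closed_term L M N \<and> closed_term L P N \<longrightarrow>
        (\<forall>m p. M \<leadsto>\<^sup>* num m \<and> P \<leadsto>\<^sup>* num p \<longrightarrow>
           (m \<noteq> p \<longrightarrow> neq \<cdot> M \<cdot> P \<leadsto>\<^sup>* num 0) \<and>
           (m = p \<longrightarrow> (\<exists>k. k \<noteq> 0 \<and> neq \<cdot> M \<cdot> P \<leadsto>\<^sup>* num k))) \<and>
        (diverges M \<or> diverges P \<longrightarrow> diverges (neq \<cdot> M \<cdot> P)))"

end

theory Submission
  imports Defs
begin

text \<open>
  All languages are sublanguages of one language, so all the translated programs can be compared
  there by a step-indexed logical relation: \<open>M\<close> approximates \<open>M'\<close> at index \<open>k\<close> if every numeral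
  that \<open>M\<close>, applied to arguments, reaches within \<open>k\<close> steps is also reached by \<open>M'\<close> applied to
  arguments related to them. This relation is a congruence. Each of \<open>rec\<close>, \<open>min\<close> and \<open>while\<close> is
  related in both directions to its implementation in PCF + byval, since both unfold in the same
  way; and \<open>while\<close> is related to the loop by minimization, since the state after \<open>n\<close> rounds is the
  \<open>n\<close>-fold iterate that \<open>rec\<close> recomputes. Relatedness is not known to be transitive, but
  its consequence at type \<open>N\<close> is, and this suffices to go from one translation to the other through
  the original term.

  The behaviour of \<open>neq\<close> is specified on typed arguments only. Since \<open>neq\<close> is related to
  itself, it is determined on arbitrary arguments by its behaviour on numerals and one divergent
  term.
\<close>

section \<open>Determinism\<close>

text \<open>Two obstacles shape the proof. At higher types \<open>ifzero\<close> does not in general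
  reduce to the chosen branch: it waits for the next argument or projection. So some unfolding laws,
  notably that of the implemented \<open>rec\<close>, hold only up to the relation and are stated
  with \<open>expands_to\<close>. Moreover, related arguments are arbitrary closed terms, so
  evaluation may get stuck at something other than a numeral; \<open>blocked\<close> and
  \<open>strict_ctx\<close> ensure that such a term stays harmless under every elimination.

  Steps are counted on the left only. An unfolding on the left pays for the next round of an
  induction on the index, while the right side may reduce for as long as it likes. This makes it
  harmless that the loop by minimization recomputes the state from the start in every round. The
  delicate direction has that loop on the left: its condition is evaluated out of sight, inside
  \<open>neq\<close>, and must still be seen to have a value within the index.\<close>

primrec spine :: "tm \<Rightarrow> (cnst \<times> tm list) option" where
  "spine (Var i) = None"
| "spine (Const c) = Some (c, [])"
| "spine (Lam \<sigma> M) = None"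
| "spine (M \<cdot> P) = map_option (\<lambda>(c, Xs). (c, Xs @ [P])) (spine M)"
| "spine (Pair M P) = None"
| "spine (Fst M) = None"
| "spine (Snd M) = None"

text \<open>The number of arguments already collected when the next one makes the constant fire; for
  \<open>byval\<close> these are the function and the arguments before the numeral. A numeral gets 0
  and never fires, so it is over-applied as soon as it is applied at all.\<close>

primrec last_arg :: "cnst \<Rightarrow> nat" where
  "last_arg (CNum n) = 0"
| "last_arg CSuc = 0"
| "last_arg CPre = 0"
| "last_arg CIfzero = 0"
| "last_arg (CY \<sigma>) = 0"
| "last_arg (CWhile \<sigma>) = 2"
| "last_arg (CRec \<sigma>) = 2"
| "last_arg CMin = 1"
| "last_arg (CByval \<sigma>s \<tau>) = Suc (length \<sigma>s)"

primrec strict_cnst :: "cnst \<Rightarrow> bool" where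
  "strict_cnst (CNum n) = False"
| "strict_cnst CSuc = True"
| "strict_cnst CPre = True"
| "strict_cnst CIfzero = True"
| "strict_cnst (CY \<sigma>) = False"
| "strict_cnst (CWhile \<sigma>) = False"
| "strict_cnst (CRec \<sigma>) = True"
| "strict_cnst CMin = True"
| "strict_cnst (CByval \<sigma>s \<tau>) = True"

primrec num_of :: "tm \<Rightarrow> nat option" where
  "num_of (Var i) = None"
| "num_of (Const c) = (case c of CNum n \<Rightarrow> Some n | _ \<Rightarrow> None)"
| "num_of (Lam \<sigma> M) = None"
| "num_of (M \<cdot> P) = None"
| "num_of (Pair M P) = None"
| "num_of (Fst M) = None"
| "num_of (Snd M) = None"

lemma num_of_eq_Some [simp]: "num_of M = Some n \<longleftrightarrow> M = num n"
  by (cases M) (auto split: cnst.splits)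

text \<open>The truncated \<open>n - 1\<close> covers both rules for \<open>pre\<close>. The value
  \<open>undefined\<close> concerns only non-strict constants, for which \<open>next_tm\<close> does
  not call this function.\<close>

definition contract_strict :: "cnst \<Rightarrow> tm list \<Rightarrow> nat \<Rightarrow> tm" where
  "contract_strict c Xs n = (case c of
     CSuc \<Rightarrow> num (Suc n)
   | CPre \<Rightarrow> num (n - 1)
   | CIfzero \<Rightarrow> Lam N (Lam N (Var (if n = 0 then 1 else 0)))
   | CRec \<sigma> \<Rightarrow> (case n of
        0 \<Rightarrow> Xs ! 0
      | Suc m \<Rightarrow> Xs ! 1 \<cdot> (Const c \<cdot> Xs ! 0 \<cdot> Xs ! 1 \<cdot> num m) \<cdot> num m)
   | CMin \<Rightarrow> Const CIfzero \<cdot> (Xs ! 0 \<cdot> num n) \<cdot> num n \<cdot> (Const CMin \<cdot> Xs ! 0 \<cdot> (Const CSuc \<cdot> num n))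
   | CByval \<sigma>s \<tau> \<Rightarrow> apps (hd Xs) (tl Xs) \<cdot> num n
   | _ \<Rightarrow> undefined)"

definition contract_lazy :: "cnst \<Rightarrow> tm list \<Rightarrow> tm \<Rightarrow> tm option" where
  "contract_lazy c Xs P = (case c of
     CY \<sigma> \<Rightarrow> Some (P \<cdot> (Const c \<cdot> P))
   | CWhile \<sigma> \<Rightarrow>
       Some (ifzero \<sigma> \<cdot> (Xs ! 0 \<cdot> Xs ! 1) \<cdot> (Const c \<cdot> Xs ! 0 \<cdot> (P \<cdot> Xs ! 1) \<cdot> P) \<cdot> Xs ! 1)
   | _ \<Rightarrow> None)"

text \<open>Reduction as a function: determinism becomes immediate, and concrete reduction sequences
  can be run by the simplifier. A head constant is inspected only once the function part is
  irreducible.\<close>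

primrec next_tm :: "tm \<Rightarrow> tm option" where
  "next_tm (Var i) = None"
| "next_tm (Const c) = None"
| "next_tm (Lam \<sigma> M) = None"
| "next_tm (M \<cdot> P) = (case next_tm M of
     Some M' \<Rightarrow> Some (M' \<cdot> P)
   | None \<Rightarrow> (case M of
       Lam \<sigma> B \<Rightarrow> Some (subst B P 0)
     | _ \<Rightarrow> (case spine M of
         None \<Rightarrow> None
       | Some (c, Xs) \<Rightarrow>
           if length Xs \<noteq> last_arg c then None
           else if strict_cnst c then (case num_of P of
               Some n \<Rightarrow> Some (contract_strict c Xs n)
             | None \<Rightarrow> map_option (App M) (next_tm P))
           else contract_lazy c Xs P)))"
| "next_tm (Pair M P) = None"
| "next_tm (Fst M) = (case next_tm M of
     Some M' \<Rightarrow> Some (Fst M')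
   | None \<Rightarrow> (case M of Pair P Q \<Rightarrow> Some P | _ \<Rightarrow> None))"
| "next_tm (Snd M) = (case next_tm M of
     Some M' \<Rightarrow> Some (Snd M')
   | None \<Rightarrow> (case M of Pair P Q \<Rightarrow> Some Q | _ \<Rightarrow> None))"

lemma spine_apps: "spine (apps M Ys) = map_option (\<lambda>(c, Xs). (c, Xs @ Ys)) (spine M)"
  by (cases "spine M"; induction Ys rule: rev_induct) auto

lemma spine_SomeD: "spine M = Some (c, Xs) \<Longrightarrow> M = apps (Const c) Xs"
  by (induction M arbitrary: Xs) auto

lemma next_tm_App:
  assumes "next_tm M = None" "spine M = Some (c, Xs)"
  shows "next_tm (M \<cdot> P) =
    (if length Xs \<noteq> last_arg c then None
     else if strict_cnst c then (case num_of P of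
         Some n \<Rightarrow> Some (contract_strict c Xs n)
       | None \<Rightarrow> map_option (App M) (next_tm P))
     else contract_lazy c Xs P)"
  using assms by (cases M) auto

text \<open>A constant with too few arguments is irreducible. Argument lists of any length are
  needed because the arity of \<open>byval\<close> is a parameter.\<close>

lemma next_tm_apps:
  assumes "next_tm M = None" "spine M = Some (c, Xs)" "length Xs + length Ys \<le> last_arg c"
  shows "next_tm (apps M Ys) = None"
  using assms(3)
proof (induction Ys rule: rev_induct)
  case Nil
  then show ?case using assms by simp
next
  case (snoc Y Ys)
  have "spine (apps M Ys) = Some (c, Xs @ Ys)"
    using assms by (simp add: spine_apps)
  moreover have "next_tm (apps M Ys) = None"
    using snoc by simp
  ultimately show ?case
    using next_tm_App[of "apps M Ys"] snoc.prems by simp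
qed

lemma next_tm_byval:
  "length Xs = length \<sigma>s \<Longrightarrow> next_tm (apps (Const (CByval \<sigma>s \<tau>) \<cdot> F) Xs) = None"
  by (rule next_tm_apps) auto

lemma step_next_tm: "M \<leadsto> M' \<Longrightarrow> next_tm M = Some M'"
proof (induction rule: step.induct)
  \<comment> \<open>In the two \<open>byval\<close> rules the number of arguments is not fixed, so
    the head constant and its argument list are supplied by hand.\<close>
  case (14 Xs \<sigma>s \<tau> F n)
  then show ?case
    by (subst next_tm_App[where c = "CByval \<sigma>s \<tau>" and Xs = "F # Xs"])
       (auto simp: next_tm_byval spine_apps contract_strict_def)
next
  case (23 M M' Xs \<sigma>s \<tau> F)
  then show ?case
    by (subst next_tm_App[where c = "CByval \<sigma>s \<tau>" and Xs = "F # Xs"])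
       (auto simp: next_tm_byval spine_apps split: option.splits)
qed (auto simp: contract_strict_def contract_lazy_def split: option.splits)

lemma length_eq_2: "length Xs = 2 \<longleftrightarrow> (\<exists>X Y. Xs = [X, Y])"
  by (auto simp: numeral_2_eq_2 length_Suc_conv)

lemma contract_strict_step:
  assumes "length Xs = last_arg c" "strict_cnst c"
  shows "apps (Const c) Xs \<cdot> num n \<leadsto> contract_strict c Xs n"
proof (cases c)
  case CPre
  then show ?thesis using assms step.intros(5,6) by (cases n) (auto simp: contract_strict_def)
next
  case CIfzero
  then show ?thesis using assms step.intros(7,8) by (cases n) (auto simp: contract_strict_def)
next
  case (CRec \<sigma>)
  then obtain X F where "Xs = [X, F]" using assms by (auto simp: length_eq_2)
  with CRec show ?thesis using step.intros(11,12) by (cases n) (auto simp: contract_strict_def)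
next
  case CMin
  then obtain F where "Xs = [F]" using assms by (auto simp: length_Suc_conv)
  with CMin show ?thesis using step.intros(13) by (auto simp: contract_strict_def)
next
  case (CByval \<sigma>s \<tau>)
  then obtain F Ys where "Xs = F # Ys" "length Ys = length \<sigma>s"
    using assms by (auto simp: length_Suc_conv)
  with CByval show ?thesis using step.intros(14) by (simp add: contract_strict_def)
qed (use assms step.intros(4) in \<open>simp_all add: contract_strict_def\<close>)

lemma contract_lazy_step:
  assumes "length Xs = last_arg c" "contract_lazy c Xs P = Some R"
  shows "apps (Const c) Xs \<cdot> P \<leadsto> R"
proof (cases c)
  case (CWhile \<sigma>)
  then obtain C X where "Xs = [C, X]" using assms by (auto simp: length_eq_2)
  with CWhile show ?thesis using assms step.intros(10) by (auto simp: contract_lazy_def)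
qed (use assms step.intros(9) in \<open>auto simp: contract_lazy_def\<close>)

lemma strict_step:
  assumes "length Xs = last_arg c" "strict_cnst c" "M \<leadsto> M'"
  shows "apps (Const c) Xs \<cdot> M \<leadsto> apps (Const c) Xs \<cdot> M'"
proof (cases c)
  case (CRec \<sigma>)
  then obtain X F where "Xs = [X, F]" using assms by (auto simp: length_eq_2)
  with CRec show ?thesis using step.intros(21)[OF assms(3)] by simp
next
  case CMin
  then obtain F where "Xs = [F]" using assms by (auto simp: length_Suc_conv)
  with CMin show ?thesis using step.intros(22)[OF assms(3)] by simp
next
  case (CByval \<sigma>s \<tau>)
  then obtain F Ys where "Xs = F # Ys" "length Ys = length \<sigma>s"
    using assms by (auto simp: length_Suc_conv)
  with CByval show ?thesis using step.intros(23)[OF assms(3)] by simp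
qed (use assms step.intros(16-18) in simp_all)

lemma next_tm_step: "next_tm M = Some M' \<Longrightarrow> M \<leadsto> M'"
proof (induction M arbitrary: M')
  case (App M P)
  show ?case
  proof (cases "next_tm M")
    case (Some T)
    then show ?thesis using App step.intros(15) by auto
  next
    case None
    show ?thesis
    proof (cases "\<exists>\<sigma> B. M = Lam \<sigma> B")
      case True
      then show ?thesis using App.prems step.intros(3) by auto
    next
      case False
      have "next_tm (M \<cdot> P) = None" if "spine M = None"
        using None False that by (cases M) auto
      with App.prems obtain c Xs where sp: "spine M = Some (c, Xs)"
        by fastforce
      from App.prems next_tm_App[OF None sp, of P]
      have len: "length Xs = last_arg c"
        and R: "(if strict_cnst c then (case num_of P of
               Some n \<Rightarrow> Some (contract_strict c Xs n)
             | None \<Rightarrow> map_option (App M) (next_tm P))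
           else contract_lazy c Xs P) = Some M'"
        by (simp_all split: if_splits)
      from sp have M: "M = apps (Const c) Xs" by (rule spine_SomeD)
      show ?thesis
      proof (cases "strict_cnst c")
        case True
        show ?thesis
        proof (cases "num_of P")
          case None
          with R True obtain P' where "next_tm P = Some P'" "M' = M \<cdot> P'"
            by auto
          then show ?thesis
            using App.IH(2) strict_step[OF len True] M by simp
        next
          case (Some n)
          then have "P = num n" "M' = contract_strict c Xs n" using R True by auto
          then show ?thesis using contract_strict_step[OF len True] M by simp
        qed
      next
        case False
        then show ?thesis using R len by (simp add: M contract_lazy_step)
      qed
    qed
  qed
next
  case (Fst M)
  show ?case
  proof (cases "next_tm M")
    case None
    with Fst.prems obtain P Q where "M = Pair P Q"
      by (cases M) simp_all
    then show ?thesis using Fst.prems step.intros(1) by simp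
  next
    case (Some T)
    then show ?thesis using Fst step.intros(19) by auto
  qed
next
  case (Snd M)
  show ?case
  proof (cases "next_tm M")
    case None
    with Snd.prems obtain P Q where "M = Pair P Q"
      by (cases M) simp_all
    then show ?thesis using Snd.prems step.intros(2) by simp
  next
    case (Some T)
    then show ?thesis using Snd step.intros(20) by auto
  qed
qed auto

lemma step_iff: "M \<leadsto> M' \<longleftrightarrow> next_tm M = Some M'"
  using step_next_tm next_tm_step by blast

lemma step_deterministic: "M \<leadsto> T \<Longrightarrow> M \<leadsto> T' \<Longrightarrow> T = T'"
  by (simp add: step_iff)

section \<open>Closed terms and simultaneous substitution\<close>

primrec bounded_vars :: "nat \<Rightarrow> tm \<Rightarrow> bool" where
  "bounded_vars k (Var i) \<longleftrightarrow> i < k"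
| "bounded_vars k (Const c) \<longleftrightarrow> True"
| "bounded_vars k (Lam \<sigma> M) \<longleftrightarrow> bounded_vars (Suc k) M"
| "bounded_vars k (M \<cdot> P) \<longleftrightarrow> bounded_vars k M \<and> bounded_vars k P"
| "bounded_vars k (Pair M P) \<longleftrightarrow> bounded_vars k M \<and> bounded_vars k P"
| "bounded_vars k (Fst M) \<longleftrightarrow> bounded_vars k M"
| "bounded_vars k (Snd M) \<longleftrightarrow> bounded_vars k M"

abbreviation closed :: "tm \<Rightarrow> bool" where "closed \<equiv> bounded_vars 0"

lemma bounded_vars_mono: "bounded_vars k M \<Longrightarrow> k \<le> l \<Longrightarrow> bounded_vars l M"
proof (induction M arbitrary: k l)
  case (Lam \<sigma> M)
  from Lam.IH[of "Suc k" "Suc l"] Lam.prems show ?case by simp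
qed (simp; blast)+

lemma closed_bounded_vars: "closed M \<Longrightarrow> bounded_vars k M"
  using bounded_vars_mono by blast

lemma closed_bounded_vars_Suc [simp]: "closed M \<Longrightarrow> bounded_vars (Suc k) M"
  by (rule closed_bounded_vars)

lemma lift_bounded_vars: "bounded_vars k M \<Longrightarrow> lift M k = M"
  by (induction M arbitrary: k) auto

lemma subst_bounded_vars: "bounded_vars k M \<Longrightarrow> subst M S k = M"
  by (induction M arbitrary: k S) auto

lemma lift_closed [simp]: "closed M \<Longrightarrow> lift M k = M"
  by (simp add: lift_bounded_vars closed_bounded_vars[of M k])

lemma subst_closed [simp]: "closed M \<Longrightarrow> subst M S k = M"
  by (simp add: subst_bounded_vars closed_bounded_vars[of M k])

text \<open>Simultaneous substitution for the variables from \<open>d\<close> upwards, meant for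
  lists of closed terms: hence nothing is lifted under a binder.\<close>

primrec inst :: "tm \<Rightarrow> nat \<Rightarrow> tm list \<Rightarrow> tm" where
  "inst (Var i) d \<gamma> = (if d \<le> i \<and> i - d < length \<gamma> then \<gamma> ! (i - d) else Var i)"
| "inst (Const c) d \<gamma> = Const c"
| "inst (Lam \<sigma> M) d \<gamma> = Lam \<sigma> (inst M (Suc d) \<gamma>)"
| "inst (M \<cdot> P) d \<gamma> = inst M d \<gamma> \<cdot> inst P d \<gamma>"
| "inst (Pair M P) d \<gamma> = Pair (inst M d \<gamma>) (inst P d \<gamma>)"
| "inst (Fst M) d \<gamma> = Fst (inst M d \<gamma>)"
| "inst (Snd M) d \<gamma> = Snd (inst M d \<gamma>)"

lemma inst_bounded_vars: "bounded_vars d M \<Longrightarrow> inst M d \<gamma> = M"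
  by (induction M arbitrary: d) auto

lemma inst_closed [simp]: "closed M \<Longrightarrow> inst M d \<gamma> = M"
  by (simp add: inst_bounded_vars closed_bounded_vars[of M d])

lemma bounded_vars_inst:
  "bounded_vars (d + length \<gamma>) M \<Longrightarrow> \<forall>P\<in>set \<gamma>. closed P \<Longrightarrow> bounded_vars d (inst M d \<gamma>)"
proof (induction M arbitrary: d)
  case (Var i)
  show ?case
  proof (cases "d \<le> i")
    case True
    with Var(1) have "i - d < length \<gamma>" by auto
    with Var(2) True show ?thesis by (simp add: closed_bounded_vars)
  qed simp
next
  case (Lam \<sigma> M)
  from Lam.IH[of "Suc d"] Lam.prems show ?case by simp
qed auto

text \<open>The beta step behind the abstraction case of the fundamental lemma: the argument joins
  the front of the environment. The bound on the variables excludes indices beyond the environment,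
  which \<open>subst\<close> would decrement and \<open>inst\<close> would not.\<close>

lemma subst_inst:
  assumes "\<forall>Q\<in>set \<gamma>. closed Q" "closed P" "bounded_vars (Suc (d + length \<gamma>)) M"
  shows "subst (inst M (Suc d) \<gamma>) P d = inst M d (P # \<gamma>)"
  using assms
proof (induction M arbitrary: d)
  case (Var i)
  show ?case
  proof (cases "d < i")
    case True
    then obtain j where i: "i = Suc (d + j)" by (auto dest: less_imp_Suc_add)
    with Var(3) have j: "j < length \<gamma>" by simp
    with Var(1) have "closed (\<gamma> ! j)" by simp
    with i j show ?thesis by simp
  next
    case False
    then show ?thesis by (cases "i = d") simp_all
  qed
next
  case (Lam \<sigma> M)
  from Lam.IH[of "Suc d"] Lam.prems show ?case by simp
qed auto

section \<open>Blocked terms and evaluation contexts\<close>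

text \<open>A blocked term stays irreducible under any further elimination.\<close>

definition blocked :: "tm \<Rightarrow> bool" where
  "blocked M \<longleftrightarrow> next_tm M = None \<and> (\<forall>\<sigma> B. M \<noteq> Lam \<sigma> B) \<and> (\<forall>P Q. M \<noteq> Pair P Q) \<and>
     (\<forall>c Xs. spine M = Some (c, Xs) \<longrightarrow> last_arg c < length Xs)"

text \<open>Without a head constant only a beta redex could arise, and abstractions are excluded;
  with one, too many arguments have been collected for it to fire.\<close>

lemma blocked_App:
  assumes "blocked M"
  shows "blocked (M \<cdot> P)"
proof (cases "spine M")
  case None
  with assms have "next_tm (M \<cdot> P) = None"
    by (cases M) (auto simp: blocked_def)
  with None show ?thesis by (simp add: blocked_def)
next
  case (Some a)
  then obtain c Xs where "spine M = Some (c, Xs)" by (cases a) auto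
  with assms show ?thesis
    unfolding blocked_def by (subst next_tm_App) fastforce+
qed

lemma blocked_Fst: "blocked M \<Longrightarrow> blocked (Fst M)"
  by (cases M) (auto simp: blocked_def)

lemma blocked_Snd: "blocked M \<Longrightarrow> blocked (Snd M)"
  by (cases M) (auto simp: blocked_def)

lemma blocked_not_step: "blocked M \<Longrightarrow> \<not> M \<leadsto> M'"
  by (simp add: blocked_def step_iff)

lemma blocked_not_num: "blocked M \<Longrightarrow> M \<noteq> num n"
  by (auto simp: blocked_def)

text \<open>A semantic description of the evaluation contexts that demand a numeral. The second
  clause is for untyped arguments: a hole stuck at anything but a numeral blocks the whole
  term.\<close>

definition strict_ctx :: "(tm \<Rightarrow> tm) \<Rightarrow> bool" where
  "strict_ctx E \<longleftrightarrow> (\<forall>M M'. M \<leadsto> M' \<longrightarrow> E M \<leadsto> E M') \<and>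
     (\<forall>M. next_tm M = None \<longrightarrow> num_of M = None \<longrightarrow> blocked (E M))"

lemma strict_ctx_Const:
  assumes "strict_cnst c" "length Xs = last_arg c"
  shows "strict_ctx (App (apps (Const c) Xs))"
proof -
  have "spine (apps (Const c) Xs) = Some (c, Xs)" "next_tm (apps (Const c) Xs) = None"
    using assms by (simp_all add: spine_apps next_tm_apps)
  with assms show ?thesis
    unfolding strict_ctx_def blocked_def
    by (auto simp: next_tm_App simp del: next_tm.simps intro: strict_step split: option.splits)
qed

lemma strict_ctx_App: "strict_ctx E \<Longrightarrow> strict_ctx (\<lambda>M. E M \<cdot> P)"
  by (auto simp: strict_ctx_def intro: step.intros(15) blocked_App)

text \<open>A blocked term is itself stuck and not a numeral, so it blocks the outer context in
  turn.\<close>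

lemma strict_ctx_comp: "strict_ctx E \<Longrightarrow> strict_ctx D \<Longrightarrow> strict_ctx (\<lambda>M. E (D M))"
  by (simp add: strict_ctx_def) (metis blocked_def blocked_not_num num_of_eq_Some not_None_eq)

lemma strict_ctx_step: "strict_ctx E \<Longrightarrow> M \<leadsto> M' \<Longrightarrow> E M \<leadsto> E M'"
  by (simp add: strict_ctx_def)

lemma steps_cong: "M \<leadsto>\<^sup>* M' \<Longrightarrow> (\<And>M M'. M \<leadsto> M' \<Longrightarrow> E M \<leadsto> E M') \<Longrightarrow> E M \<leadsto>\<^sup>* E M'"
  by (induction rule: rtranclp_induct) (auto intro: rtranclp.intros(2))

lemma strict_ctx_steps: "strict_ctx E \<Longrightarrow> M \<leadsto>\<^sup>* M' \<Longrightarrow> E M \<leadsto>\<^sup>* E M'"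
  by (rule steps_cong) (auto dest: strict_ctx_step)

lemmas strict_ctxs =
  strict_ctx_Const[of CSuc "[]", simplified]
  strict_ctx_Const[of CPre "[]", simplified]
  strict_ctx_Const[of CIfzero "[]", simplified]
  strict_ctx_Const[of "CRec \<sigma>" "[X, F]" for \<sigma> X F, simplified]
  strict_ctx_Const[of CMin "[F]" for F, simplified]
  strict_ctx_Const[of "CByval [] \<tau>" "[F]" for \<tau> F, simplified]
  strict_ctx_Const[of "CByval [\<sigma>] \<tau>" "[F, X]" for \<sigma> \<tau> F X, simplified]
  strict_ctx_Const[of "CByval [\<sigma>, \<sigma>'] \<tau>" "[F, X, X']" for \<sigma> \<sigma>' \<tau> F X X', simplified]

lemma num_not_step: "\<not> num n \<leadsto> M"
  by (simp add: step_iff)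

lemma steps_num: "num n \<leadsto>\<^sup>* M \<longleftrightarrow> M = num n"
  by (auto elim: converse_rtranclpE simp: num_not_step)

lemma steps_num_unique: "M \<leadsto>\<^sup>* num m \<Longrightarrow> M \<leadsto>\<^sup>* num n \<Longrightarrow> m = n"
proof (induction rule: converse_rtranclp_induct)
  case base
  then show ?case by (simp add: steps_num)
next
  case (step M M')
  from step.prems step.hyps(1) have "M' \<leadsto>\<^sup>* num n"
    by (cases rule: converse_rtranclpE) (auto simp: num_not_step dest: step_deterministic)
  then show ?case by (rule step.IH)
qed

section \<open>Step-indexed approximation\<close>

text \<open>
  Arguments range over all closed terms, typed or not. At function and product types nothing is
  asked about convergence of the terms themselves, because only numerals are observed.
\<close>

primrec approx :: "ty \<Rightarrow> nat \<Rightarrow> tm \<Rightarrow> tm \<Rightarrow> bool" where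
  "approx N k M M' \<longleftrightarrow> (\<forall>j\<le>k. \<forall>n. (step ^^ j) M (num n) \<longrightarrow> M' \<leadsto>\<^sup>* num n)"
| "approx (\<sigma> \<rightarrow> \<tau>) k M M' \<longleftrightarrow> (\<forall>j\<le>k. \<forall>P P'. closed P \<longrightarrow> closed P' \<longrightarrow>
     approx \<sigma> j P P' \<longrightarrow> approx \<tau> j (M \<cdot> P) (M' \<cdot> P'))"
| "approx (\<sigma> \<otimes> \<tau>) k M M' \<longleftrightarrow> approx \<sigma> k (Fst M) (Fst M') \<and> approx \<tau> k (Snd M) (Snd M')"

lemma approx_mono: "approx \<sigma> k M M' \<Longrightarrow> j \<le> k \<Longrightarrow> approx \<sigma> j M M'"
  by (induction \<sigma> arbitrary: M M') (auto intro: le_trans)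

lemma approx_app:
  "approx (\<sigma> \<rightarrow> \<tau>) k M M' \<Longrightarrow> closed P \<Longrightarrow> closed P' \<Longrightarrow> approx \<sigma> k P P' \<Longrightarrow>
     approx \<tau> k (M \<cdot> P) (M' \<cdot> P')"
  by simp

lemma approx_blocked: "blocked M \<Longrightarrow> approx \<sigma> k M M'"
proof (induction \<sigma> arbitrary: k M M')
  case N
  have "\<not> (step ^^ j) M (num n)" for j n
    using N blocked_not_num blocked_not_step by (cases j) (auto dest!: relpowp_Suc_D2 simp del: relpowp.simps(2))
  then show ?case by simp
next
  case (Fun \<sigma> \<tau>)
  then show ?case by (simp add: blocked_App)
next
  case (Prod \<sigma> \<tau>)
  then show ?case by (simp add: blocked_Fst blocked_Snd)
qed

text \<open>Within zero steps only a numeral is observed, and applications and projections are never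
  numerals.\<close>

lemma approx_0: "num_of M = None \<Longrightarrow> approx \<sigma> 0 M M'"
  by (induction \<sigma> arbitrary: M M') auto

text \<open>A step on the left gains one unit of index; the inductions over unbounded loops live on
  this. Head steps persist under application and projection, so the gain carries over to all
  types.\<close>

lemma approx_expand_left_Suc:
  "M \<leadsto> M1 \<Longrightarrow> approx \<sigma> k M1 M' \<Longrightarrow> approx \<sigma> (Suc k) M M'"
proof (induction \<sigma> arbitrary: k M M1 M')
  case N
  have "M' \<leadsto>\<^sup>* num n" if "j \<le> Suc k" "(step ^^ j) M (num n)" for j n
  proof (cases j)
    case 0
    with that N.prems(1) show ?thesis by (auto simp: num_not_step)
  next
    case (Suc i)
    with that(2) obtain T where "M \<leadsto> T" "(step ^^ i) T (num n)"
      by (metis relpowp_Suc_D2)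
    with N.prems that(1) Suc show ?thesis by (auto dest: step_deterministic)
  qed
  then show ?case by simp
next
  case (Fun \<sigma> \<tau>)
  have "approx \<tau> j (M \<cdot> P) (M' \<cdot> P')"
    if "j \<le> Suc k" "closed P" "closed P'" "approx \<sigma> j P P'" for j P P'
  proof (cases j)
    case 0
    then show ?thesis by (simp add: approx_0)
  next
    case (Suc i)
    from approx_mono[OF that(4), of i] Suc have "approx \<sigma> i P P'" by simp
    with Suc that Fun.prems show ?thesis
      by (auto intro!: Fun.IH(2)[of _ "M1 \<cdot> P"] step.intros(15))
  qed
  then show ?case by simp
next
  case (Prod \<sigma> \<tau>)
  then show ?case
    using Prod.IH(1)[OF step.intros(19)] Prod.IH(2)[OF step.intros(20)] by simp
qed

lemma approx_expand_left: "M \<leadsto>\<^sup>* M1 \<Longrightarrow> approx \<sigma> k M1 M' \<Longrightarrow> approx \<sigma> k M M'"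
  by (induction rule: converse_rtranclp_induct)
     (auto dest!: approx_expand_left_Suc elim: approx_mono)

text \<open>The form used for loops: an unfolding of at least one step leaves the rest to be shown
  at the predecessor index, and at index 0 nothing is left, since a reducible term is not a
  numeral.\<close>

lemma approx_expand_left_plus:
  assumes "step\<^sup>+\<^sup>+ M M1" "\<And>j. k = Suc j \<Longrightarrow> approx \<sigma> j M1 M'"
  shows "approx \<sigma> k M M'"
proof -
  from assms(1) obtain T where T: "M \<leadsto> T" "T \<leadsto>\<^sup>* M1"
    by (meson tranclpD)
  show ?thesis
  proof (cases k)
    case 0
    from T(1) have "num_of M = None" by (cases "num_of M") (auto simp: num_not_step)
    with 0 show ?thesis by (simp add: approx_0)
  next
    case (Suc j)
    with T assms(2) show ?thesis by (auto intro: approx_expand_left_Suc approx_expand_left)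
  qed
qed

lemma approx_expand_right: "M' \<leadsto>\<^sup>* M1 \<Longrightarrow> approx \<sigma> k M M1 \<Longrightarrow> approx \<sigma> k M M'"
proof (induction \<sigma> arbitrary: k M M' M1)
  case N
  then show ?case by (auto intro: rtranclp_trans)
next
  case (Fun \<sigma> \<tau>)
  have "M' \<cdot> P \<leadsto>\<^sup>* M1 \<cdot> P" for P
    by (rule steps_cong[where E = "\<lambda>M. M \<cdot> P", OF Fun.prems(1) step.intros(15)])
  with Fun.prems show ?case using Fun.IH(2) by simp blast
next
  case (Prod \<sigma> \<tau>)
  have "Fst M' \<leadsto>\<^sup>* Fst M1"
    by (rule steps_cong[OF Prod.prems(1) step.intros(19)])
  moreover have "Snd M' \<leadsto>\<^sup>* Snd M1"
    by (rule steps_cong[OF Prod.prems(1) step.intros(20)])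
  ultimately show ?case using Prod by auto
qed

text \<open>Three things can happen to the hole: it reaches a numeral in \<open>i\<close> steps,
  which reduces the remaining obligation to index \<open>k - i\<close>; it gets stuck and blocks the
  context; or it outlasts the index. Only the first needs an argument.\<close>

lemma approx_bind:
  assumes "strict_ctx E"
    and "\<And>i n. i \<le> k \<Longrightarrow> (step ^^ i) M (num n) \<Longrightarrow> approx \<tau> (k - i) (E (num n)) Q"
  shows "approx \<tau> k (E M) Q"
  using assms(2)
proof (induction k arbitrary: M)
  case 0
  show ?case
  proof (cases "num_of M")
    case (Some n)
    then show ?thesis using "0.prems"[of 0 n] by simp
  next
    case None
    show ?thesis
    proof (cases "next_tm M")
      case None
      with \<open>num_of M = None\<close> assms(1) show ?thesis by (simp add: strict_ctx_def approx_blocked)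
    next
      case (Some M1)
      then have "E M \<leadsto> E M1" using assms(1) by (simp add: step_iff[symmetric] strict_ctx_def)
      then have "num_of (E M) = None" by (cases "num_of (E M)") (auto simp: num_not_step)
      then show ?thesis by (rule approx_0)
    qed
  qed
next
  case (Suc k)
  show ?case
  proof (cases "num_of M")
    case (Some n)
    then show ?thesis using Suc.prems[of 0 n] by simp
  next
    case None
    show ?thesis
    proof (cases "next_tm M")
      case None
      with \<open>num_of M = None\<close> assms(1) show ?thesis by (simp add: strict_ctx_def approx_blocked)
    next
      case (Some M1)
      then have M1: "M \<leadsto> M1" by (simp add: step_iff)
      have "approx \<tau> k (E M1) Q"
        using Suc.prems M1 by (intro Suc.IH) (metis Suc_le_mono diff_Suc_Suc relpowp_Suc_I2)
      then show ?thesis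
        using approx_expand_left_Suc strict_ctx_step[OF assms(1) M1] by blast
    qed
  qed
qed

lemma approx_bind_both:
  assumes "strict_ctx E" "strict_ctx E'" "approx N k M M'"
    and "\<And>n. M' \<leadsto>\<^sup>* num n \<Longrightarrow> approx \<tau> k (E (num n)) (E' (num n))"
  shows "approx \<tau> k (E M) (E' M')"
proof (rule approx_bind[OF assms(1)])
  fix i n assume "i \<le> k" "(step ^^ i) M (num n)"
  with assms(3) have M': "M' \<leadsto>\<^sup>* num n" by simp
  then have "approx \<tau> k (E (num n)) (E' M')"
    by (blast intro: approx_expand_right strict_ctx_steps assms)
  then show "approx \<tau> (k - i) (E (num n)) (E' M')" by (rule approx_mono) simp
qed

text \<open>Fuelled execution, by which a concrete reduction sequence is checked by rewriting. In
  its uses the fuel is the number of steps, mostly spelled with \<open>Suc\<close> to match the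
  equations.\<close>

primrec drive :: "nat \<Rightarrow> tm \<Rightarrow> tm" where
  "drive 0 M = M"
| "drive (Suc n) M = (case next_tm M of Some M' \<Rightarrow> drive n M' | None \<Rightarrow> M)"

lemma steps_drive: "M \<leadsto>\<^sup>* drive n M"
proof (induction n arbitrary: M)
  case (Suc n)
  show ?case
    using converse_rtranclp_into_rtranclp[OF next_tm_step Suc.IH] by (cases "next_tm M") auto
qed simp

lemma steps_driveI: "drive n M = T \<Longrightarrow> M \<leadsto>\<^sup>* T"
  using steps_drive by blast

lemma plus_driveI: "next_tm M = Some M' \<Longrightarrow> drive n M' = T \<Longrightarrow> step\<^sup>+\<^sup>+ M T"
  using rtranclp_into_tranclp2[of step, OF next_tm_step] steps_drive by blast

section \<open>Conditionals\<close>

lemma closed_ifzero [simp]: "closed (ifzero \<sigma>)"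
  by (induction \<sigma>) auto

lemma ifzero_N_steps:
  assumes "closed X" "closed Y"
  shows "Const CIfzero \<cdot> num n \<cdot> X \<cdot> Y \<leadsto>\<^sup>* (if n = 0 then X else Y)"
  using assms by (intro steps_driveI[of 3]) (simp add: numeral_3_eq_3 contract_strict_def)

lemma ifzero_Fun_steps:
  assumes "closed P" "closed X" "closed Y" "closed Z"
  shows "ifzero (\<sigma> \<rightarrow> \<tau>) \<cdot> P \<cdot> X \<cdot> Y \<cdot> Z \<leadsto>\<^sup>* ifzero \<tau> \<cdot> P \<cdot> (X \<cdot> Z) \<cdot> (Y \<cdot> Z)"
  using assms by (intro steps_driveI[of "Suc (Suc (Suc (Suc 0)))"]) simp

lemma ifzero_Prod_steps:
  assumes "closed P" "closed X" "closed Y"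
  shows "Fst (ifzero (\<sigma> \<otimes> \<tau>) \<cdot> P \<cdot> X \<cdot> Y) \<leadsto>\<^sup>* ifzero \<sigma> \<cdot> P \<cdot> Fst X \<cdot> Fst Y"
    and "Snd (ifzero (\<sigma> \<otimes> \<tau>) \<cdot> P \<cdot> X \<cdot> Y) \<leadsto>\<^sup>* ifzero \<tau> \<cdot> P \<cdot> Snd X \<cdot> Snd Y"
  using assms by (auto intro!: steps_driveI[of "Suc (Suc (Suc (Suc 0)))"])

text \<open>Induction on the type: further arguments and projections are pushed into the branches
  until the conditional has type \<open>N\<close>, where the test is at last evaluated. Its
  \<open>i\<close> steps are what the branches no longer have to account for.\<close>

lemma approx_ifzero_left:
  assumes "closed P" "closed X" "closed Y"
    and "\<And>i n. i \<le> k \<Longrightarrow> (step ^^ i) P (num n) \<Longrightarrow> approx \<sigma> (k - i) (if n = 0 then X else Y) Q"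
  shows "approx \<sigma> k (ifzero \<sigma> \<cdot> P \<cdot> X \<cdot> Y) Q"
  using assms(2-)
proof (induction \<sigma> arbitrary: k X Y Q)
  case N
  show ?case
    unfolding ifzero.simps
  proof (rule approx_bind[where E = "\<lambda>P. Const CIfzero \<cdot> P \<cdot> X \<cdot> Y"])
    show "strict_ctx (\<lambda>P. Const CIfzero \<cdot> P \<cdot> X \<cdot> Y)"
      by (intro strict_ctx_App strict_ctxs)
    show "approx N (k - i) (Const CIfzero \<cdot> num n \<cdot> X \<cdot> Y) Q"
      if "i \<le> k" "(step ^^ i) P (num n)" for i n
      using approx_expand_left[OF ifzero_N_steps N(3)] N(1,2) that by blast
  qed
next
  case (Fun \<sigma> \<tau>)
  have "approx \<tau> j (ifzero (\<sigma> \<rightarrow> \<tau>) \<cdot> P \<cdot> X \<cdot> Y \<cdot> Z) (Q \<cdot> Z')"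
    if j: "j \<le> k" "closed Z" "closed Z'" "approx \<sigma> j Z Z'" for j Z Z'
  proof (rule approx_expand_left[OF ifzero_Fun_steps], fact assms(1), fact Fun, fact Fun, fact that)
    show "approx \<tau> j (ifzero \<tau> \<cdot> P \<cdot> (X \<cdot> Z) \<cdot> (Y \<cdot> Z)) (Q \<cdot> Z')"
    proof (rule Fun.IH(2))
      fix i n assume i: "i \<le> j" "(step ^^ i) P (num n)"
      \<comment> \<open>Arguments arrive at a smaller index \<open>j\<close>, so the branch
        hypothesis at \<open>k - i\<close> is lowered to \<open>j - i\<close>.\<close>
      then have "i \<le> k" "j - i \<le> k - i" using j by auto
      then have "approx (\<sigma> \<rightarrow> \<tau>) (j - i) (if n = 0 then X else Y) Q"
        using approx_mono[OF Fun.prems(3)[OF _ i(2)]] by blast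
      from approx_app[OF this j(2,3)] approx_mono[OF j(4)]
      show "approx \<tau> (j - i) (if n = 0 then X \<cdot> Z else Y \<cdot> Z) (Q \<cdot> Z')"
        by (cases n) auto
    qed (use Fun j in simp_all)
  qed
  then show ?case by simp
next
  case (Prod \<sigma> \<tau>)
  have "approx \<sigma> k (Fst (ifzero (\<sigma> \<otimes> \<tau>) \<cdot> P \<cdot> X \<cdot> Y)) (Fst Q)"
  proof (rule approx_expand_left[OF ifzero_Prod_steps(1)], fact assms(1), fact Prod, fact Prod,
      rule Prod.IH(1))
    show "approx \<sigma> (k - i) (if n = 0 then Fst X else Fst Y) (Fst Q)"
      if "i \<le> k" "(step ^^ i) P (num n)" for i n
      using Prod.prems(3)[OF that] by (cases n) auto
  qed (use Prod in simp_all)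
  moreover have "approx \<tau> k (Snd (ifzero (\<sigma> \<otimes> \<tau>) \<cdot> P \<cdot> X \<cdot> Y)) (Snd Q)"
  proof (rule approx_expand_left[OF ifzero_Prod_steps(2)], fact assms(1), fact Prod, fact Prod,
      rule Prod.IH(2))
    show "approx \<tau> (k - i) (if n = 0 then Snd X else Snd Y) (Snd Q)"
      if "i \<le> k" "(step ^^ i) P (num n)" for i n
      using Prod.prems(3)[OF that] by (cases n) auto
  qed (use Prod in simp_all)
  ultimately show ?case by simp
qed

text \<open>The same induction. On the right the test needs a value, no matter after how many steps,
  and the index is untouched.\<close>

lemma approx_ifzero_right:
  assumes "closed P" "closed X" "closed Y" "P \<leadsto>\<^sup>* num n"
    and "approx \<sigma> k Q (if n = 0 then X else Y)"
  shows "approx \<sigma> k Q (ifzero \<sigma> \<cdot> P \<cdot> X \<cdot> Y)"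
  using assms(2,3,5)
proof (induction \<sigma> arbitrary: k X Y Q)
  case N
  have "Const CIfzero \<cdot> P \<cdot> X \<cdot> Y \<leadsto>\<^sup>* Const CIfzero \<cdot> num n \<cdot> X \<cdot> Y"
    by (rule strict_ctx_steps[where E = "\<lambda>P. Const CIfzero \<cdot> P \<cdot> X \<cdot> Y"])
       (intro strict_ctx_App strict_ctxs, rule assms(4))
  also have "\<dots> \<leadsto>\<^sup>* (if n = 0 then X else Y)"
    using N by (intro ifzero_N_steps)
  finally show ?case using N by (simp only: ifzero.simps) (rule approx_expand_right)
next
  case (Fun \<sigma> \<tau>)
  have "approx \<tau> j (Q \<cdot> Z) (ifzero (\<sigma> \<rightarrow> \<tau>) \<cdot> P \<cdot> X \<cdot> Y \<cdot> Z')"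
    if j: "j \<le> k" "closed Z" "closed Z'" "approx \<sigma> j Z Z'" for j Z Z'
  proof (rule approx_expand_right[OF ifzero_Fun_steps], fact assms(1), fact Fun, fact Fun, fact that)
    have "approx (\<sigma> \<rightarrow> \<tau>) j Q (if n = 0 then X else Y)"
      using approx_mono[OF Fun.prems(3)] j by simp
    from approx_app[OF this j(2-4)]
    show "approx \<tau> j (Q \<cdot> Z) (ifzero \<tau> \<cdot> P \<cdot> (X \<cdot> Z') \<cdot> (Y \<cdot> Z'))"
      using Fun.prems j by (intro Fun.IH(2)) (auto split: if_splits)
  qed
  then show ?case by simp
next
  case (Prod \<sigma> \<tau>)
  have "approx \<sigma> k (Fst Q) (Fst (ifzero (\<sigma> \<otimes> \<tau>) \<cdot> P \<cdot> X \<cdot> Y))"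
    using Prod.prems
    by (intro approx_expand_right[OF ifzero_Prod_steps(1)] Prod.IH(1) assms(1)) (auto split: if_splits)
  moreover have "approx \<tau> k (Snd Q) (Snd (ifzero (\<sigma> \<otimes> \<tau>) \<cdot> P \<cdot> X \<cdot> Y))"
    using Prod.prems
    by (intro approx_expand_right[OF ifzero_Prod_steps(2)] Prod.IH(2) assms(1)) (auto split: if_splits)
  ultimately show ?case by simp
qed

text \<open>Unfolding that is usable on both sides without counting steps. It covers reduction, and
  also the choice of a branch by \<open>ifzero\<close> at higher types, which in general is no
  reduction.\<close>

definition expands_to :: "ty \<Rightarrow> tm \<Rightarrow> tm \<Rightarrow> bool" where
  "expands_to \<sigma> M M1 \<longleftrightarrow>
     (\<forall>k Q. (approx \<sigma> k M1 Q \<longrightarrow> approx \<sigma> k M Q) \<and> (approx \<sigma> k Q M1 \<longrightarrow> approx \<sigma> k Q M))"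

lemma expands_to_steps: "M \<leadsto>\<^sup>* M1 \<Longrightarrow> expands_to \<sigma> M M1"
  unfolding expands_to_def using approx_expand_left approx_expand_right by blast

lemma expands_to_trans: "expands_to \<sigma> M M1 \<Longrightarrow> expands_to \<sigma> M1 M2 \<Longrightarrow> expands_to \<sigma> M M2"
  by (simp add: expands_to_def)

lemma expands_to_ifzero:
  assumes "closed X" "closed Y"
  shows "expands_to \<sigma> (ifzero \<sigma> \<cdot> num n \<cdot> X \<cdot> Y) (if n = 0 then X else Y)"
proof -
  have m: "m = n" if "(step ^^ i) (num n) (num m)" for i m
    using relpowp_imp_rtranclp[OF that] by (simp add: steps_num)
  have "approx \<sigma> k (ifzero \<sigma> \<cdot> num n \<cdot> X \<cdot> Y) Q" if "approx \<sigma> k (if n = 0 then X else Y) Q" for k Q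
  proof (rule approx_ifzero_left)
    show "approx \<sigma> (k - i) (if m = 0 then X else Y) Q" if "(step ^^ i) (num n) (num m)" for i m
      using m[OF that] approx_mono[OF \<open>approx \<sigma> k _ Q\<close>] by simp
  qed (use assms in simp_all)
  moreover have "approx \<sigma> k Q (ifzero \<sigma> \<cdot> num n \<cdot> X \<cdot> Y)" if "approx \<sigma> k Q (if n = 0 then X else Y)" for k Q
    using that assms by (intro approx_ifzero_right) auto
  ultimately show ?thesis by (simp add: expands_to_def)
qed

section \<open>The fundamental lemma\<close>

definition approx_env :: "nat \<Rightarrow> ty list \<Rightarrow> tm list \<Rightarrow> tm list \<Rightarrow> bool" where
  "approx_env k \<Gamma> \<gamma> \<gamma>' \<longleftrightarrow> length \<gamma> = length \<Gamma> \<and> length \<gamma>' = length \<Gamma> \<and>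
     (\<forall>i<length \<Gamma>. closed (\<gamma> ! i) \<and> closed (\<gamma>' ! i) \<and> approx (\<Gamma> ! i) k (\<gamma> ! i) (\<gamma>' ! i))"

definition open_approx :: "ty list \<Rightarrow> tm \<Rightarrow> tm \<Rightarrow> ty \<Rightarrow> bool" where
  "open_approx \<Gamma> M M' \<tau> \<longleftrightarrow> bounded_vars (length \<Gamma>) M \<and> bounded_vars (length \<Gamma>) M' \<and>
     (\<forall>k \<gamma> \<gamma>'. approx_env k \<Gamma> \<gamma> \<gamma>' \<longrightarrow> approx \<tau> k (inst M 0 \<gamma>) (inst M' 0 \<gamma>'))"

abbreviation below :: "ty \<Rightarrow> tm \<Rightarrow> tm \<Rightarrow> bool" where
  "below \<sigma> M M' \<equiv> open_approx [] M M' \<sigma>"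

lemma below_iff: "below \<sigma> M M' \<longleftrightarrow> closed M \<and> closed M' \<and> (\<forall>k. approx \<sigma> k M M')"
  by (auto simp: open_approx_def approx_env_def)

lemma approx_env_mono: "approx_env k \<Gamma> \<gamma> \<gamma>' \<Longrightarrow> j \<le> k \<Longrightarrow> approx_env j \<Gamma> \<gamma> \<gamma>'"
  unfolding approx_env_def using approx_mono by blast

lemma approx_env_Cons:
  "approx_env k \<Gamma> \<gamma> \<gamma>' \<Longrightarrow> closed P \<Longrightarrow> closed P' \<Longrightarrow> approx \<sigma> k P P' \<Longrightarrow>
     approx_env k (\<sigma> # \<Gamma>) (P # \<gamma>) (P' # \<gamma>')"
  unfolding approx_env_def by (auto simp: nth_Cons split: nat.splits)

lemma approx_env_closed:
  assumes "approx_env k \<Gamma> \<gamma> \<gamma>'"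
  shows "\<forall>P\<in>set \<gamma>. closed P" "\<forall>P\<in>set \<gamma>'. closed P" "length \<gamma> = length \<Gamma>" "length \<gamma>' = length \<Gamma>"
  using assms by (auto simp: approx_env_def in_set_conv_nth)

lemma open_approx_closed: "below \<sigma> M M' \<Longrightarrow> open_approx \<Gamma> M M' \<sigma>"
  by (auto simp: open_approx_def approx_env_def intro: closed_bounded_vars)

lemma open_approx_Var: "i < length \<Gamma> \<Longrightarrow> open_approx \<Gamma> (Var i) (Var i) (\<Gamma> ! i)"
  by (auto simp: open_approx_def approx_env_def)

lemma open_approx_App:
  assumes "open_approx \<Gamma> M M' (\<sigma> \<rightarrow> \<tau>)" "open_approx \<Gamma> P P' \<sigma>"
  shows "open_approx \<Gamma> (M \<cdot> P) (M' \<cdot> P') \<tau>"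
proof -
  have "approx \<tau> k (inst (M \<cdot> P) 0 \<gamma>) (inst (M' \<cdot> P') 0 \<gamma>')" if env: "approx_env k \<Gamma> \<gamma> \<gamma>'" for k \<gamma> \<gamma>'
  proof -
    have "closed (inst P 0 \<gamma>)" "closed (inst P' 0 \<gamma>')"
      using assms(2) approx_env_closed[OF env] by (auto simp: open_approx_def intro!: bounded_vars_inst)
    moreover have "approx (\<sigma> \<rightarrow> \<tau>) k (inst M 0 \<gamma>) (inst M' 0 \<gamma>')" "approx \<sigma> k (inst P 0 \<gamma>) (inst P' 0 \<gamma>')"
      using assms env unfolding open_approx_def by blast+
    ultimately show ?thesis unfolding inst.simps by (intro approx_app)
  qed
  then show ?thesis using assms by (simp add: open_approx_def)
qed

lemma open_approx_Lam:
  assumes "open_approx (\<sigma> # \<Gamma>) M M' \<tau>"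
  shows "open_approx \<Gamma> (Lam \<sigma> M) (Lam \<sigma> M') (\<sigma> \<rightarrow> \<tau>)"
proof -
  have "approx \<tau> j (Lam \<sigma> (inst M 1 \<gamma>) \<cdot> P) (Lam \<sigma> (inst M' 1 \<gamma>') \<cdot> P')"
    if "approx_env k \<Gamma> \<gamma> \<gamma>'" "j \<le> k" "closed P" "closed P'" "approx \<sigma> j P P'" for k j \<gamma> \<gamma>' P P'
  proof -
    have env: "approx_env j (\<sigma> # \<Gamma>) (P # \<gamma>) (P' # \<gamma>')"
      using that by (intro approx_env_Cons) (auto intro: approx_env_mono)
    have "subst (inst M 1 \<gamma>) P 0 = inst M 0 (P # \<gamma>)" "subst (inst M' 1 \<gamma>') P' 0 = inst M' 0 (P' # \<gamma>')"
      using subst_inst[of \<gamma> P 0 M] subst_inst[of \<gamma>' P' 0 M'] that approx_env_closed[OF that(1)] assms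
      by (auto simp: open_approx_def)
    then have "Lam \<sigma> (inst M 1 \<gamma>) \<cdot> P \<leadsto>\<^sup>* inst M 0 (P # \<gamma>)"
      "Lam \<sigma> (inst M' 1 \<gamma>') \<cdot> P' \<leadsto>\<^sup>* inst M' 0 (P' # \<gamma>')"
      using step.intros(3)[of \<sigma> "inst M 1 \<gamma>" P] step.intros(3)[of \<sigma> "inst M' 1 \<gamma>'" P'] by auto
    moreover have "approx \<tau> j (inst M 0 (P # \<gamma>)) (inst M' 0 (P' # \<gamma>'))"
      using assms env by (simp add: open_approx_def)
    ultimately show ?thesis by (blast intro: approx_expand_left approx_expand_right)
  qed
  then show ?thesis using assms unfolding open_approx_def by auto
qed

lemma open_approx_Pair:
  assumes "open_approx \<Gamma> M M' \<sigma>" "open_approx \<Gamma> P P' \<tau>"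
  shows "open_approx \<Gamma> (Pair M P) (Pair M' P') (\<sigma> \<otimes> \<tau>)"
proof -
  have "approx (\<sigma> \<otimes> \<tau>) k (Pair M P) (Pair M' P')" if "approx \<sigma> k M M'" "approx \<tau> k P P'" for k M P M' P'
  proof -
    have "Fst (Pair M P) \<leadsto>\<^sup>* M" "Fst (Pair M' P') \<leadsto>\<^sup>* M'" "Snd (Pair M P) \<leadsto>\<^sup>* P" "Snd (Pair M' P') \<leadsto>\<^sup>* P'"
      by (auto intro: step.intros(1,2))
    with that show ?thesis by (auto intro: approx_expand_left approx_expand_right)
  qed
  with assms show ?thesis unfolding open_approx_def by auto
qed

lemma open_approx_Fst: "open_approx \<Gamma> M M' (\<sigma> \<otimes> \<tau>) \<Longrightarrow> open_approx \<Gamma> (Fst M) (Fst M') \<sigma>"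
  by (auto simp: open_approx_def)

lemma open_approx_Snd: "open_approx \<Gamma> M M' (\<sigma> \<otimes> \<tau>) \<Longrightarrow> open_approx \<Gamma> (Snd M) (Snd M') \<tau>"
  by (auto simp: open_approx_def)

text \<open>The fundamental lemma, for two translations at once. With \<open>Const\<close> for one
  of them it relates a term to its translation, with \<open>Const\<close> for both it is
  reflexivity. All that depends on particular constants is left to the second hypothesis.\<close>

lemma open_approx_replace:
  assumes "\<Gamma> \<turnstile> M : \<tau>" "\<And>c. c \<in> cnsts_of M \<Longrightarrow> below (cnst_ty c) (h c) (h' c)"
  shows "open_approx \<Gamma> (replace h M) (replace h' M) \<tau>"
  using assms
  by (induction rule: typing.induct)
     (auto intro: open_approx_Var open_approx_closed open_approx_Lam open_approx_App
        open_approx_Pair open_approx_Fst open_approx_Snd)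

lemma replace_Const: "replace Const M = M"
  by (induction M) auto

lemma open_approx_refl:
  "\<Gamma> \<turnstile> M : \<tau> \<Longrightarrow> (\<And>c. c \<in> cnsts_of M \<Longrightarrow> below (cnst_ty c) (Const c) (Const c)) \<Longrightarrow> open_approx \<Gamma> M M \<tau>"
  using open_approx_replace[of \<Gamma> M \<tau> Const Const] by (simp add: replace_Const)

text \<open>The filled-in terms are closed, so the binders of the context capture nothing and the
  hole is covered by \<open>open_approx_closed\<close>.\<close>

lemma open_approx_fill:
  assumes "ctx_typing \<kappa> \<Gamma> C \<tau>" "below \<kappa> A B"
    and "\<And>c. c \<in> ctx_cnsts_of C \<Longrightarrow> below (cnst_ty c) (Const c) (Const c)"
  shows "open_approx \<Gamma> (fill C A) (fill C B) \<tau>"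
  using assms
  by (induction rule: ctx_typing.induct)
     (auto intro: open_approx_closed open_approx_Lam open_approx_App open_approx_refl
        open_approx_Pair open_approx_Fst open_approx_Snd)

section \<open>Iterators\<close>

lemma approx_N_steps: "approx N k M M' \<Longrightarrow> i \<le> k \<Longrightarrow> (step ^^ i) M (num n) \<Longrightarrow> M' \<leadsto>\<^sup>* num n"
  by simp

text \<open>\<open>A\<close> and \<open>B\<close> send a state to the loop in that state, so the
  constant and the fixed point can stand on either side. Each unfolding of \<open>A\<close> costs a
  step, which drives the induction on the index.\<close>

lemma approx_while:
  assumes "closed C" "closed F" "closed C'" "closed F'"
    and "\<And>X. closed X \<Longrightarrow> closed (A X)" "\<And>X. closed X \<Longrightarrow> closed (B X)"
    and A: "\<And>X. closed X \<Longrightarrow> step\<^sup>+\<^sup>+ (A X) (ifzero \<sigma> \<cdot> (C \<cdot> X) \<cdot> A (F \<cdot> X) \<cdot> X)"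
    and B: "\<And>X. closed X \<Longrightarrow> B X \<leadsto>\<^sup>* ifzero \<sigma> \<cdot> (C' \<cdot> X) \<cdot> B (F' \<cdot> X) \<cdot> X"
    and "approx (\<sigma> \<rightarrow> N) k C C'" "approx (\<sigma> \<rightarrow> \<sigma>) k F F'"
    and "closed X" "closed X'" "approx \<sigma> k X X'"
  shows "approx \<sigma> k (A X) (B X')"
  using assms(9-)
proof (induction k arbitrary: X X' rule: less_induct)
  case (less k)
  note closed = assms(1-6) less.prems(3,4)
  show ?case
  proof (rule approx_expand_left_plus[OF A], fact less.prems, rule approx_ifzero_left)
    fix j i n assume k: "k = Suc j" and i: "i \<le> j" "(step ^^ i) (C \<cdot> X) (num n)"
    have "approx N k (C \<cdot> X) (C' \<cdot> X')"
      by (rule approx_app) (use less.prems in simp_all)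
    then have C': "C' \<cdot> X' \<leadsto>\<^sup>* num n"
        by (rule approx_N_steps) (use k i in auto)
    have "approx \<sigma> (j - i) (if n = 0 then A (F \<cdot> X) else X) (if n = 0 then B (F' \<cdot> X') else X')"
    proof (cases n)
      case 0
      have "approx \<sigma> (j - i) (A (F \<cdot> X)) (B (F' \<cdot> X'))"
      proof (rule less.IH)
        show "approx \<sigma> (j - i) (F \<cdot> X) (F' \<cdot> X')"
          by (rule approx_mono[OF approx_app[OF less.prems(2-5)]]) (use k in simp)
        show "approx (\<sigma> \<rightarrow> N) (j - i) C C'" "approx (\<sigma> \<rightarrow> \<sigma>) (j - i) F F'"
          by (rule approx_mono[OF less.prems(1)] approx_mono[OF less.prems(2)]; use k in simp)+
      qed (use k closed in simp_all)
      with 0 show ?thesis by simp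
    next
      case (Suc m)
      then show ?thesis using approx_mono[OF less.prems(5)] k by simp
    qed
    then have "approx \<sigma> (j - i) (if n = 0 then A (F \<cdot> X) else X)
        (ifzero \<sigma> \<cdot> (C' \<cdot> X') \<cdot> B (F' \<cdot> X') \<cdot> X')"
      using closed C' by (intro approx_ifzero_right) auto
    then show "approx \<sigma> (j - i) (if n = 0 then A (F \<cdot> X) else X) (B X')"
      using B[OF less.prems(4)] by (rule approx_expand_right[rotated])
  qed (use closed in auto)
qed

text \<open>Once the argument is a numeral, it bounds the recursion. The induction is therefore on
  the numeral at a fixed index, unfolding need not cost a step, and laws up to
  \<open>expands_to\<close> are enough.\<close>

lemma approx_rec:
  assumes "strict_ctx A" "strict_ctx B"
    and "\<And>n. closed (A (num n))" "\<And>n. closed (B (num n))"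
    and "expands_to \<sigma> (A (num 0)) X" "\<And>n. expands_to \<sigma> (A (num (Suc n))) (F \<cdot> A (num n) \<cdot> num n)"
    and "expands_to \<sigma> (B (num 0)) X'" "\<And>n. expands_to \<sigma> (B (num (Suc n))) (F' \<cdot> B (num n) \<cdot> num n)"
    and "approx \<sigma> k X X'" "approx (\<sigma> \<rightarrow> N \<rightarrow> \<sigma>) k F F'" "approx N k P P'"
  shows "approx \<sigma> k (A P) (B P')"
proof (rule approx_bind_both[OF assms(1,2,11)])
  show "approx \<sigma> k (A (num n)) (B (num n))" for n
  proof (induction n)
    case 0
    show ?case using assms(5,7,9) by (simp add: expands_to_def)
  next
    case (Suc n)
    have num: "approx N k (num n) (num n)" by (auto dest: relpowp_imp_rtranclp)
    have "approx \<sigma> k (F \<cdot> A (num n) \<cdot> num n) (F' \<cdot> B (num n) \<cdot> num n)"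
      using approx_app[OF approx_app[OF assms(10,3,4) Suc] _ _ num] by simp
    then show ?case using assms(6,8)[of n] by (simp add: expands_to_def)
  qed
qed

lemma approx_num: "approx N k (num n) (num n)"
  by (auto dest: relpowp_imp_rtranclp)

lemma approx_num_steps: "M \<leadsto>\<^sup>* num n \<Longrightarrow> approx N k (num n) M \<and> approx N k M (num n)"
  using approx_expand_left approx_expand_right approx_num by blast

text \<open>The search is unbounded, so the induction is on the index and each unfolding of
  \<open>A\<close> must cost a step. The next round starts at an unevaluated successor; strictness
  of both contexts allows replacing it by its value.\<close>

lemma approx_min:
  assumes "strict_ctx A" "strict_ctx B" "closed F" "closed F'"
    and "\<And>P. closed P \<Longrightarrow> closed (A P)" "\<And>P. closed P \<Longrightarrow> closed (B P)"
    and A: "\<And>n. step\<^sup>+\<^sup>+ (A (num n))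
          (Const CIfzero \<cdot> (F \<cdot> num n) \<cdot> num n \<cdot> A (Const CSuc \<cdot> num n))"
    and B: "\<And>n. B (num n) \<leadsto>\<^sup>* Const CIfzero \<cdot> (F' \<cdot> num n) \<cdot> num n \<cdot> B (Const CSuc \<cdot> num n)"
    and F: "approx (N \<rightarrow> N) k F F'"
    and P: "approx N k P P'"
  shows "approx N k (A P) (B P')"
proof (rule approx_bind_both[OF assms(1,2) P])
  show "approx N k (A (num n)) (B (num n))" for n
    using F
  proof (induction k arbitrary: n rule: less_induct)
    case (less k)
    show ?case
    proof (rule approx_expand_left_plus[OF A],
        rule approx_ifzero_left[where \<sigma> = N, unfolded ifzero.simps])
      fix j i m assume k: "k = Suc j" and i: "i \<le> j" "(step ^^ i) (F \<cdot> num n) (num m)"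
      have "approx N k (F \<cdot> num n) (F' \<cdot> num n)"
        by (rule approx_app[OF less.prems]) (simp_all only: approx_num bounded_vars.simps)
      then have F': "F' \<cdot> num n \<leadsto>\<^sup>* num m"
        by (rule approx_N_steps) (use k i in auto)
      have suc: "Const CSuc \<cdot> num n \<leadsto>\<^sup>* num (Suc n)"
        using step.intros(4) by blast
      have "approx N (j - i) (A (num (Suc n))) (B (num (Suc n)))"
        using approx_mono[OF less.prems, of "j - i"] k by (intro less.IH) auto
      then have "approx N (j - i) (A (Const CSuc \<cdot> num n)) (B (Const CSuc \<cdot> num n))"
        using strict_ctx_steps[OF assms(1) suc] strict_ctx_steps[OF assms(2) suc]
        by (blast intro: approx_expand_left approx_expand_right)
      then have "approx N (j - i) (if m = 0 then num n else A (Const CSuc \<cdot> num n))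
          (if m = 0 then num n else B (Const CSuc \<cdot> num n))"
        by (simp only: approx_num split: if_split) simp
      then have "approx N (j - i) (if m = 0 then num n else A (Const CSuc \<cdot> num n))
          (Const CIfzero \<cdot> (F' \<cdot> num n) \<cdot> num n \<cdot> B (Const CSuc \<cdot> num n))"
        using assms(4,6) F'
        by (intro approx_ifzero_right[where \<sigma> = N, unfolded ifzero.simps]) auto
      then show "approx N (j - i) (if m = 0 then num n else A (Const CSuc \<cdot> num n)) (B (num n))"
        using B by (rule approx_expand_right[rotated])
    qed (use assms(3,5) in auto)
  qed
qed

section \<open>Constants and their implementations\<close>

lemma below_FunI:
  assumes "closed M" "closed M'"
    and "\<And>k P P'. closed P \<Longrightarrow> closed P' \<Longrightarrow> approx \<sigma> k P P' \<Longrightarrow> approx \<tau> k (M \<cdot> P) (M' \<cdot> P')"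
  shows "below (\<sigma> \<rightarrow> \<tau>) M M'"
  using assms by (simp add: below_iff)

lemma below_num: "below N (num n) (num n)"
  by (simp only: below_iff approx_num) simp

lemma below_strict_N:
  assumes "strict_ctx (App (Const c))" "\<And>n. Const c \<cdot> num n \<leadsto>\<^sup>* num (f n)"
  shows "below (N \<rightarrow> N) (Const c) (Const c)"
proof (rule below_FunI)
  fix k P P' assume P: "approx N k P P'"
  have "approx N k (Const c \<cdot> num n) (Const c \<cdot> num n)" for n
    by (rule approx_expand_left[OF assms(2) approx_expand_right[OF assms(2) approx_num]])
  then show "approx N k (Const c \<cdot> P) (Const c \<cdot> P')"
    by (rule approx_bind_both[OF assms(1) assms(1) P])
qed simp_all

lemma below_CSuc: "below (N \<rightarrow> N) (Const CSuc) (Const CSuc)"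
  by (rule below_strict_N[where f = Suc]) (rule strict_ctxs(1), rule r_into_rtranclp, rule step.intros(4))

lemma below_CPre: "below (N \<rightarrow> N) (Const CPre) (Const CPre)"
proof (rule below_strict_N[where f = "\<lambda>n. n - 1"])
  show "Const CPre \<cdot> num n \<leadsto>\<^sup>* num (n - 1)" for n
    using step.intros(5,6) by (cases n) auto
qed (rule strict_ctxs(2))

lemma below_CIfzero: "below (N \<rightarrow> N \<rightarrow> N \<rightarrow> N) (Const CIfzero) (Const CIfzero)"
proof -
  have "approx N k (Const CIfzero \<cdot> P \<cdot> X \<cdot> Y) (Const CIfzero \<cdot> P' \<cdot> X' \<cdot> Y')"
    if "closed P" "closed P'" "approx N k P P'" "closed X" "closed X'" "approx N k X X'"
      "closed Y" "closed Y'" "approx N k Y Y'" for k P P' X X' Y Y'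
  proof (rule approx_ifzero_left[where \<sigma> = N, unfolded ifzero.simps])
    fix i n assume i: "i \<le> k" "(step ^^ i) P (num n)"
    with that(3) have "P' \<leadsto>\<^sup>* num n" by simp
    moreover have "approx N (k - i) (if n = 0 then X else Y) (if n = 0 then X' else Y')"
      using approx_mono[OF that(6), of "k - i"] approx_mono[OF that(9), of "k - i"]
      by (simp only: diff_le_self split: if_split) simp
    ultimately show "approx N (k - i) (if n = 0 then X else Y) (Const CIfzero \<cdot> P' \<cdot> X' \<cdot> Y')"
      using that by (intro approx_ifzero_right[where \<sigma> = N, unfolded ifzero.simps])
  qed (use that in auto)
  then show ?thesis
    unfolding below_iff approx.simps(2) by (simp del: approx.simps(1)) (meson approx_mono)
qed

text \<open>Unfolding costs a step, so the recursive occurrence is needed only at the predecessor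
  index.\<close>

lemma below_CY: "below ((\<sigma> \<rightarrow> \<sigma>) \<rightarrow> \<sigma>) (Const (CY \<sigma>)) (Const (CY \<sigma>))"
proof (rule below_FunI)
  fix k F F' assume "closed F" "closed F'" "approx (\<sigma> \<rightarrow> \<sigma>) k F F'"
  then show "approx \<sigma> k (Const (CY \<sigma>) \<cdot> F) (Const (CY \<sigma>) \<cdot> F')"
  proof (induction k)
    case 0
    show ?case by (simp add: approx_0)
  next
    case (Suc k)
    have F: "approx (\<sigma> \<rightarrow> \<sigma>) k F F'" using Suc.prems(3) by (rule approx_mono) simp
    have "approx \<sigma> k (F \<cdot> (Const (CY \<sigma>) \<cdot> F)) (F' \<cdot> (Const (CY \<sigma>) \<cdot> F'))"
      using Suc.prems F by (intro approx_app[OF F] Suc.IH) auto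
    then show ?case
      using step.intros(9)[of \<sigma>] by (blast intro: approx_expand_left_Suc approx_expand_right)
  qed
qed auto

text \<open>Induction over the argument types of \<open>byval\<close>. The arguments enter only
  through the relatedness of \<open>F\<close> and \<open>F'\<close> applied to them.\<close>

lemma approx_funsI:
  assumes "approx (funs \<sigma>s \<tau>) k F F'"
    and "\<And>j Xs Xs'. j \<le> k \<Longrightarrow> length Xs = length \<sigma>s \<Longrightarrow> length Xs' = length \<sigma>s \<Longrightarrow>
      approx \<tau> j (apps F Xs) (apps F' Xs') \<Longrightarrow> approx \<tau>' j (apps G Xs) (apps G' Xs')"
  shows "approx (funs \<sigma>s \<tau>') k G G'"
  using assms
proof (induction \<sigma>s arbitrary: F F' G G' k)
  case Nil
  from Nil(2)[of k "[]" "[]"] Nil(1) show ?case by simp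
next
  case (Cons \<sigma> \<sigma>s)
  have "approx (funs \<sigma>s \<tau>') j (G \<cdot> P) (G' \<cdot> P')"
    if j: "j \<le> k" "closed P" "closed P'" "approx \<sigma> j P P'" for j P P'
  proof (rule Cons.IH)
    have "approx (\<sigma> \<rightarrow> funs \<sigma>s \<tau>) j F F'" using approx_mono[OF Cons.prems(1) j(1)] by simp
    then show "approx (funs \<sigma>s \<tau>) j (F \<cdot> P) (F' \<cdot> P')"
      using j by (intro approx_app)
    show "approx \<tau>' i (apps (G \<cdot> P) Xs) (apps (G' \<cdot> P') Xs')"
      if "i \<le> j" "length Xs = length \<sigma>s" "length Xs' = length \<sigma>s"
        "approx \<tau> i (apps (F \<cdot> P) Xs) (apps (F' \<cdot> P') Xs')" for i Xs Xs'
      using Cons.prems(2)[of i "P # Xs" "P' # Xs'"] that j by simp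
  qed
  then show ?case by simp
qed

lemma below_CByval:
  "below (funs \<sigma>s (N \<rightarrow> \<tau>) \<rightarrow> funs \<sigma>s (N \<rightarrow> \<tau>)) (Const (CByval \<sigma>s \<tau>)) (Const (CByval \<sigma>s \<tau>))"
proof (rule below_FunI)
  fix k F F' assume "approx (funs \<sigma>s (N \<rightarrow> \<tau>)) k F F'"
  then show "approx (funs \<sigma>s (N \<rightarrow> \<tau>)) k (Const (CByval \<sigma>s \<tau>) \<cdot> F) (Const (CByval \<sigma>s \<tau>) \<cdot> F')"
  proof (rule approx_funsI)
    fix j Xs Xs'
    assume Xs: "length Xs = length \<sigma>s" "length Xs' = length \<sigma>s"
      and FX: "approx (N \<rightarrow> \<tau>) j (apps F Xs) (apps F' Xs')"
    let ?B = "\<lambda>F Xs. apps (Const (CByval \<sigma>s \<tau>) \<cdot> F) Xs"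
    have strict: "strict_ctx (App (?B F Xs))" "strict_ctx (App (?B F' Xs'))"
      using strict_ctx_Const[of "CByval \<sigma>s \<tau>" "F # Xs"]
        strict_ctx_Const[of "CByval \<sigma>s \<tau>" "F' # Xs'"] Xs by simp_all
    have "approx \<tau> i (?B F Xs \<cdot> P) (?B F' Xs' \<cdot> P')" if "i \<le> j" "approx N i P P'" for i P P'
    proof (rule approx_bind_both[OF strict that(2)])
      fix n
      have "?B F Xs \<cdot> num n \<leadsto>\<^sup>* apps F Xs \<cdot> num n" "?B F' Xs' \<cdot> num n \<leadsto>\<^sup>* apps F' Xs' \<cdot> num n"
        using step.intros(14) Xs by blast+
      moreover have "approx \<tau> i (apps F Xs \<cdot> num n) (apps F' Xs' \<cdot> num n)"
        using approx_mono[OF FX that(1)] by (rule approx_app) (simp_all only: approx_num bounded_vars.simps)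
      ultimately show "approx \<tau> i (?B F Xs \<cdot> num n) (?B F' Xs' \<cdot> num n)"
        by (blast intro: approx_expand_left approx_expand_right)
    qed
    then show "approx (N \<rightarrow> \<tau>) j (?B F Xs) (?B F' Xs')"
      by (simp del: approx.simps(1))
  qed
qed auto

section \<open>The loop constant and its implementation by a fixed point\<close>

definition while_step :: "ty \<Rightarrow> tm \<Rightarrow> tm \<Rightarrow> tm" where
  "while_step \<sigma> C F = Lam (\<sigma> \<rightarrow> \<sigma>) (Lam \<sigma>
     (ifzero \<sigma> \<cdot> (C \<cdot> Var 0) \<cdot> (Var 1 \<cdot> (F \<cdot> Var 0)) \<cdot> Var 0))"

lemma closed_while_step [simp]: "closed C \<Longrightarrow> closed F \<Longrightarrow> closed (while_step \<sigma> C F)"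
  by (simp add: while_step_def)

text \<open>\<open>While_PCF\<close> does not recur through itself: after three beta steps the
  iteration takes place in the fixed point alone, and it is this form that is compared with
  \<open>while\<close>.\<close>

lemma While_PCF_steps:
  assumes "closed C" "closed X" "closed F"
  shows "While_PCF \<sigma> \<cdot> C \<cdot> X \<cdot> F \<leadsto>\<^sup>* Const (CY (\<sigma> \<rightarrow> \<sigma>)) \<cdot> while_step \<sigma> C F \<cdot> X"
  using assms by (intro steps_driveI[of "Suc (Suc (Suc 0))"]) (simp add: While_PCF_def while_step_def)

lemma while_step_unfold:
  assumes "closed C" "closed F" "closed X"
  shows "step\<^sup>+\<^sup>+ (Const (CY (\<sigma> \<rightarrow> \<sigma>)) \<cdot> while_step \<sigma> C F \<cdot> X)
    (ifzero \<sigma> \<cdot> (C \<cdot> X) \<cdot> (Const (CY (\<sigma> \<rightarrow> \<sigma>)) \<cdot> while_step \<sigma> C F \<cdot> (F \<cdot> X)) \<cdot> X)"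
proof (rule plus_driveI)
  show "drive (Suc (Suc 0)) (while_step \<sigma> C F \<cdot> (Const (CY (\<sigma> \<rightarrow> \<sigma>)) \<cdot> while_step \<sigma> C F) \<cdot> X) =
    ifzero \<sigma> \<cdot> (C \<cdot> X) \<cdot> (Const (CY (\<sigma> \<rightarrow> \<sigma>)) \<cdot> while_step \<sigma> C F \<cdot> (F \<cdot> X)) \<cdot> X"
    using assms by (simp add: while_step_def)
qed (simp add: contract_lazy_def)

lemma closed_While_PCF [simp]: "closed (While_PCF \<sigma>)"
  by (simp add: While_PCF_def)

lemma CWhile_unfold: "step\<^sup>+\<^sup>+ (Const (CWhile \<sigma>) \<cdot> C \<cdot> X \<cdot> F)
    (ifzero \<sigma> \<cdot> (C \<cdot> X) \<cdot> (Const (CWhile \<sigma>) \<cdot> C \<cdot> (F \<cdot> X) \<cdot> F) \<cdot> X)"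
  by (rule tranclp.r_into_trancl, rule step.intros(10))

text \<open>Unfolding the relation gives three successively smaller indices; monotonicity brings all
  arguments down to the last.\<close>

lemma below_Fun3I:
  assumes "closed M" "closed M'"
    and "\<And>k P P' Q Q' R R'. \<lbrakk>closed P; closed P'; closed Q; closed Q'; closed R; closed R';
      approx \<rho> k P P'; approx \<sigma> k Q Q'; approx \<tau> k R R'\<rbrakk> \<Longrightarrow>
      approx \<upsilon> k (M \<cdot> P \<cdot> Q \<cdot> R) (M' \<cdot> P' \<cdot> Q' \<cdot> R')"
  shows "below (\<rho> \<rightarrow> \<sigma> \<rightarrow> \<tau> \<rightarrow> \<upsilon>) M M'"
proof -
  have "approx (\<rho> \<rightarrow> \<sigma> \<rightarrow> \<tau> \<rightarrow> \<upsilon>) k M M'" for k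
    unfolding approx.simps(2) by (intro allI impI assms(3)) (auto intro: approx_mono)
  with assms(1,2) show ?thesis unfolding below_iff by blast
qed

lemma below_CWhile_While_PCF: "below (while_ty \<sigma>) (Const (CWhile \<sigma>)) (While_PCF \<sigma>)"
proof (rule below_Fun3I)
  fix k C C' X X' F F'
  assume *: "closed C" "closed C'" "closed X" "closed X'" "closed F" "closed F'"
    "approx (\<sigma> \<rightarrow> N) k C C'" "approx \<sigma> k X X'" "approx (\<sigma> \<rightarrow> \<sigma>) k F F'"
  have "approx \<sigma> k (Const (CWhile \<sigma>) \<cdot> C \<cdot> X \<cdot> F)
      (Const (CY (\<sigma> \<rightarrow> \<sigma>)) \<cdot> while_step \<sigma> C' F' \<cdot> X')"
    by (rule approx_while[where A = "\<lambda>X. Const (CWhile \<sigma>) \<cdot> C \<cdot> X \<cdot> F"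
          and B = "\<lambda>X. Const (CY (\<sigma> \<rightarrow> \<sigma>)) \<cdot> while_step \<sigma> C' F' \<cdot> X"])
       (use * CWhile_unfold tranclp_into_rtranclp[OF while_step_unfold] in \<open>simp_all del: approx.simps\<close>)
  then show "approx \<sigma> k (Const (CWhile \<sigma>) \<cdot> C \<cdot> X \<cdot> F) (While_PCF \<sigma> \<cdot> C' \<cdot> X' \<cdot> F')"
    using While_PCF_steps[OF *(2,4,6)] by (rule approx_expand_right[rotated])
qed simp_all

lemma below_While_PCF_CWhile: "below (while_ty \<sigma>) (While_PCF \<sigma>) (Const (CWhile \<sigma>))"
proof (rule below_Fun3I)
  fix k C C' X X' F F'
  assume *: "closed C" "closed C'" "closed X" "closed X'" "closed F" "closed F'"
    "approx (\<sigma> \<rightarrow> N) k C C'" "approx \<sigma> k X X'" "approx (\<sigma> \<rightarrow> \<sigma>) k F F'"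
  have "approx \<sigma> k (Const (CY (\<sigma> \<rightarrow> \<sigma>)) \<cdot> while_step \<sigma> C F \<cdot> X)
      (Const (CWhile \<sigma>) \<cdot> C' \<cdot> X' \<cdot> F')"
    by (rule approx_while[where B = "\<lambda>X. Const (CWhile \<sigma>) \<cdot> C' \<cdot> X \<cdot> F'"
          and A = "\<lambda>X. Const (CY (\<sigma> \<rightarrow> \<sigma>)) \<cdot> while_step \<sigma> C F \<cdot> X"])
       (use * tranclp_into_rtranclp[OF CWhile_unfold] while_step_unfold in \<open>simp_all del: approx.simps\<close>)
  with While_PCF_steps[OF *(1,3,5)]
  show "approx \<sigma> k (While_PCF \<sigma> \<cdot> C \<cdot> X \<cdot> F) (Const (CWhile \<sigma>) \<cdot> C' \<cdot> X' \<cdot> F')"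
    by (rule approx_expand_left)
qed simp_all

section \<open>Primitive recursion and its implementation\<close>

definition rec_step :: "ty \<Rightarrow> tm" where
  "rec_step \<sigma> = Lam (rec_ty \<sigma>) (Lam \<sigma> (Lam (\<sigma> \<rightarrow> N \<rightarrow> \<sigma>) (Lam N
         (ifzero \<sigma> \<cdot> Var 0 \<cdot> Var 2 \<cdot>
           (Const (CByval [] \<sigma>) \<cdot>
              Lam N (Var 2 \<cdot> (byval_plus \<sigma> \<cdot> Var 4 \<cdot> Var 3 \<cdot> Var 2 \<cdot> Var 0) \<cdot> Var 0) \<cdot>
            (Const CPre \<cdot> Var 0))))))"

lemma Rec_PCF_eq: "Rec_PCF \<sigma> = byval_plus \<sigma> \<cdot> (Const (CY (rec_ty \<sigma>)) \<cdot> rec_step \<sigma>)"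
  by (simp add: Rec_PCF_def rec_step_def)

lemma closed_rec_step [simp]: "closed (rec_step \<sigma>)"
  by (simp add: rec_step_def)

lemma closed_Rec_PCF [simp]: "closed (Rec_PCF \<sigma>)"
  by (simp add: Rec_PCF_eq)

text \<open>This is the purpose of the outer \<open>byval_plus\<close>: the fixed point alone would
  pass the number on unevaluated, whereas \<open>rec\<close> evaluates it first.\<close>

lemma strict_ctx_Rec_PCF: "strict_ctx (App (Rec_PCF \<sigma> \<cdot> X \<cdot> F))"
  unfolding Rec_PCF_eq by (rule strict_ctxs)

lemma Y_rec_step_steps: "Const (CY (rec_ty \<sigma>)) \<cdot> rec_step \<sigma> \<cdot> X \<cdot> F \<cdot> P \<leadsto>\<^sup>*
    rec_step \<sigma> \<cdot> (Const (CY (rec_ty \<sigma>)) \<cdot> rec_step \<sigma>) \<cdot> X \<cdot> F \<cdot> P"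
  by (intro steps_driveI[of "Suc 0"]) (simp add: contract_lazy_def)

lemma rec_step_steps:
  assumes "closed R" "closed X" "closed F" "closed P"
  shows "rec_step \<sigma> \<cdot> R \<cdot> X \<cdot> F \<cdot> P \<leadsto>\<^sup>*
    ifzero \<sigma> \<cdot> P \<cdot> X \<cdot> (Const (CByval [] \<sigma>) \<cdot>
        Lam N (F \<cdot> (byval_plus \<sigma> \<cdot> R \<cdot> X \<cdot> F \<cdot> Var 0) \<cdot> Var 0) \<cdot> (Const CPre \<cdot> P))"
  using assms by (intro steps_driveI[of "Suc (Suc (Suc (Suc 0)))"]) (simp add: rec_step_def)

text \<open>The recursive call inside the functional carries its own \<open>byval_plus\<close>, so
  after unfolding it is \<open>Rec_PCF\<close> again.\<close>

lemma Rec_PCF_steps: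
  assumes "closed X" "closed F"
  shows "Rec_PCF \<sigma> \<cdot> X \<cdot> F \<cdot> num n \<leadsto>\<^sup>*
    ifzero \<sigma> \<cdot> num n \<cdot> X \<cdot> (Const (CByval [] \<sigma>) \<cdot>
        Lam N (F \<cdot> (Rec_PCF \<sigma> \<cdot> X \<cdot> F \<cdot> Var 0) \<cdot> Var 0) \<cdot> (Const CPre \<cdot> num n))"
proof -
  have "Rec_PCF \<sigma> \<cdot> X \<cdot> F \<cdot> num n \<leadsto>\<^sup>* Const (CY (rec_ty \<sigma>)) \<cdot> rec_step \<sigma> \<cdot> X \<cdot> F \<cdot> num n"
    using step.intros(14)[of "[X, F]" "[\<sigma>, \<sigma> \<rightarrow> N \<rightarrow> \<sigma>]"] unfolding Rec_PCF_eq by auto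
  also note Y_rec_step_steps
  also note rec_step_steps
  finally show ?thesis using assms by (simp add: Rec_PCF_eq)
qed

text \<open>The inner \<open>byval\<close> evaluates the predecessor before \<open>F\<close> is
  called, so the numeral itself appears in both places, as in the rule for
  \<open>rec\<close>.\<close>

lemma byval_rec_steps:
  assumes "closed R" "closed F"
  shows "Const (CByval [] \<sigma>) \<cdot> Lam N (F \<cdot> (R \<cdot> Var 0) \<cdot> Var 0) \<cdot> (Const CPre \<cdot> num (Suc n)) \<leadsto>\<^sup>*
    F \<cdot> (R \<cdot> num n) \<cdot> num n"
  using assms
  by (intro steps_driveI[of "Suc (Suc (Suc 0))"]) (simp add: contract_strict_def)

text \<open>The reduction ends at a conditional of type \<sigma>; from there on the step to the
  branch is one of \<open>expands_to\<close>.\<close>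

lemma expands_to_Rec_PCF:
  assumes "closed X" "closed F"
  shows "expands_to \<sigma> (Rec_PCF \<sigma> \<cdot> X \<cdot> F \<cdot> num n) (if n = 0 then X else
    Const (CByval [] \<sigma>) \<cdot> Lam N (F \<cdot> (Rec_PCF \<sigma> \<cdot> X \<cdot> F \<cdot> Var 0) \<cdot> Var 0) \<cdot> (Const CPre \<cdot> num n))"
  by (rule expands_to_trans[OF expands_to_steps[OF Rec_PCF_steps[OF assms]] expands_to_ifzero])
     (use assms in simp_all)

lemma expands_to_Rec_PCF_Suc:
  assumes "closed X" "closed F"
  shows "expands_to \<sigma> (Rec_PCF \<sigma> \<cdot> X \<cdot> F \<cdot> num (Suc n)) (F \<cdot> (Rec_PCF \<sigma> \<cdot> X \<cdot> F \<cdot> num n) \<cdot> num n)"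
  using expands_to_trans[OF expands_to_Rec_PCF[OF assms, of \<sigma> "Suc n", simplified]
      expands_to_steps[OF byval_rec_steps]] assms by simp

lemma expands_to_CRec:
  "expands_to \<sigma> (Const (CRec \<sigma>) \<cdot> X \<cdot> F \<cdot> num 0) X"
  "expands_to \<sigma> (Const (CRec \<sigma>) \<cdot> X \<cdot> F \<cdot> num (Suc n)) (F \<cdot> (Const (CRec \<sigma>) \<cdot> X \<cdot> F \<cdot> num n) \<cdot> num n)"
  by (rule expands_to_steps, rule r_into_rtranclp, rule step.intros)+

text \<open>What \<open>approx_rec\<close> asks of one side. A single lemma then relates the
  constant and the program in either direction, and the constant to itself.\<close>

definition implements_rec :: "ty \<Rightarrow> tm \<Rightarrow> bool" where
  "implements_rec \<sigma> R \<longleftrightarrow> closed R \<and> (\<forall>X F. strict_ctx (App (R \<cdot> X \<cdot> F)) \<and>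
     (closed X \<longrightarrow> closed F \<longrightarrow> expands_to \<sigma> (R \<cdot> X \<cdot> F \<cdot> num 0) X \<and>
       (\<forall>n. expands_to \<sigma> (R \<cdot> X \<cdot> F \<cdot> num (Suc n)) (F \<cdot> (R \<cdot> X \<cdot> F \<cdot> num n) \<cdot> num n))))"

lemma implements_rec_CRec: "implements_rec \<sigma> (Const (CRec \<sigma>))"
  unfolding implements_rec_def using expands_to_CRec strict_ctxs(4) by simp

lemma implements_rec_Rec_PCF: "implements_rec \<sigma> (Rec_PCF \<sigma>)"
  unfolding implements_rec_def
  using expands_to_Rec_PCF[where n = 0] expands_to_Rec_PCF_Suc strict_ctx_Rec_PCF by simp

lemma below_implements_rec:
  assumes "implements_rec \<sigma> R" "implements_rec \<sigma> R'"
  shows "below (rec_ty \<sigma>) R R'"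
proof (rule below_Fun3I)
  fix k X X' F F' P P'
  assume *: "closed X" "closed X'" "closed F" "closed F'" "closed P" "closed P'"
    "approx \<sigma> k X X'" "approx (\<sigma> \<rightarrow> N \<rightarrow> \<sigma>) k F F'" "approx N k P P'"
  show "approx \<sigma> k (R \<cdot> X \<cdot> F \<cdot> P) (R' \<cdot> X' \<cdot> F' \<cdot> P')"
    by (rule approx_rec[OF _ _ _ _ _ _ _ _ *(7-9)])
       (use assms * in \<open>simp_all add: implements_rec_def\<close>)
qed (use assms in \<open>simp_all add: implements_rec_def\<close>)

section \<open>Minimization and its implementation\<close>

definition implements_min :: "tm \<Rightarrow> bool" where
  "implements_min R \<longleftrightarrow> closed R \<and> (\<forall>F. strict_ctx (App (R \<cdot> F)) \<and>
     (closed F \<longrightarrow> (\<forall>n. step\<^sup>+\<^sup>+ (R \<cdot> F \<cdot> num n)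
        (Const CIfzero \<cdot> (F \<cdot> num n) \<cdot> num n \<cdot> (R \<cdot> F \<cdot> (Const CSuc \<cdot> num n))))))"

lemma implements_min_CMin: "implements_min (Const CMin)"
  unfolding implements_min_def using strict_ctxs(5) tranclp.r_into_trancl[of step, OF step.intros(13)]
  by simp

definition min_step :: tm where
  "min_step = Lam min_ty (Lam (N \<rightarrow> N) (Lam N
         (Const CIfzero \<cdot> (Var 1 \<cdot> Var 0) \<cdot> Var 0 \<cdot>
           (Const (CByval [N \<rightarrow> N] N) \<cdot> Var 2 \<cdot> Var 1 \<cdot> (Const CSuc \<cdot> Var 0)))))"

lemma Min_PCF_eq: "Min_PCF = Const (CByval [N \<rightarrow> N] N) \<cdot> (Const (CY min_ty) \<cdot> min_step)"
  by (simp add: Min_PCF_def min_step_def)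

lemma closed_min_step [simp]: "closed min_step"
  by (simp add: min_step_def)

lemma min_step_steps:
  assumes "closed R" "closed F" "closed P"
  shows "min_step \<cdot> R \<cdot> F \<cdot> P \<leadsto>\<^sup>*
    Const CIfzero \<cdot> (F \<cdot> P) \<cdot> P \<cdot> (Const (CByval [N \<rightarrow> N] N) \<cdot> R \<cdot> F \<cdot> (Const CSuc \<cdot> P))"
  using assms by (intro steps_driveI[of "Suc (Suc (Suc 0))"]) (simp add: min_step_def)

text \<open>Here the index has to go down, so real steps are required instead of
  \<open>expands_to\<close>. They are available because the unfolding stops before its conditional
  is decided.\<close>

lemma implements_min_Min_PCF: "implements_min Min_PCF"
proof -
  have "step\<^sup>+\<^sup>+ (Min_PCF \<cdot> F \<cdot> num n)
      (Const CIfzero \<cdot> (F \<cdot> num n) \<cdot> num n \<cdot> (Min_PCF \<cdot> F \<cdot> (Const CSuc \<cdot> num n)))"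
    if "closed F" for F n
  proof -
    have "Min_PCF \<cdot> F \<cdot> num n \<leadsto> Const (CY min_ty) \<cdot> min_step \<cdot> F \<cdot> num n"
      using step.intros(14)[of "[F]" "[N \<rightarrow> N]"] unfolding Min_PCF_eq by auto
    moreover have "Const (CY min_ty) \<cdot> min_step \<cdot> F \<cdot> num n \<leadsto>\<^sup>*
        min_step \<cdot> (Const (CY min_ty) \<cdot> min_step) \<cdot> F \<cdot> num n"
      by (intro steps_driveI[of "Suc 0"]) (simp add: contract_lazy_def)
    moreover have "min_step \<cdot> (Const (CY min_ty) \<cdot> min_step) \<cdot> F \<cdot> num n \<leadsto>\<^sup>*
        Const CIfzero \<cdot> (F \<cdot> num n) \<cdot> num n \<cdot> (Min_PCF \<cdot> F \<cdot> (Const CSuc \<cdot> num n))"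
      unfolding Min_PCF_eq using that by (intro min_step_steps) simp_all
    ultimately show ?thesis by (meson rtranclp_into_tranclp2 rtranclp_trans)
  qed
  then show ?thesis
    unfolding implements_min_def using strict_ctxs(7) by (simp add: Min_PCF_eq)
qed

lemma below_implements_min:
  assumes "implements_min R" "implements_min R'"
  shows "below min_ty R R'"
proof (rule below_FunI)
  fix k F F' assume *: "closed F" "closed F'" "approx (N \<rightarrow> N) k F F'"
  have "approx N j (R \<cdot> F \<cdot> P) (R' \<cdot> F' \<cdot> P')"
    if "j \<le> k" "approx N j P P'" for j P P'
    by (rule approx_min[OF _ _ *(1,2) _ _ _ _ approx_mono[OF *(3) that(1)] that(2)])
       (use assms * in \<open>simp_all add: implements_min_def tranclp_into_rtranclp\<close>)
  then show "approx (N \<rightarrow> N) k (R \<cdot> F) (R' \<cdot> F')"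
    unfolding approx.simps(2) by blast
qed (use assms in \<open>simp_all add: implements_min_def\<close>)

section \<open>All constants of the two target languages\<close>

lemma below_T_min_cnst: "c \<in> lang_T_min \<Longrightarrow> below (cnst_ty c) (Const c) (Const c)"
  using below_num below_CSuc below_CPre below_CIfzero
    below_implements_rec[OF implements_rec_CRec implements_rec_CRec]
    below_implements_min[OF implements_min_CMin implements_min_CMin]
  by (auto simp: lang_T_min_def lang_B_def)

lemma below_PCF_cnst: "c \<in> lang_PCF_byval \<Longrightarrow> below (cnst_ty c) (Const c) (Const c)"
  using below_num below_CSuc below_CPre below_CIfzero below_CY below_CByval
  by (auto simp: lang_PCF_byval_def lang_B_def)

lemma below_steps: "below N M M' \<Longrightarrow> M \<leadsto>\<^sup>* num n \<Longrightarrow> M' \<leadsto>\<^sup>* num n"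
  unfolding below_iff by (meson approx_N_steps order_refl rtranclp_imp_relpowp)

lemma below_App: "below (\<sigma> \<rightarrow> \<tau>) M M' \<Longrightarrow> below \<sigma> P P' \<Longrightarrow> below \<tau> (M \<cdot> P) (M' \<cdot> P')"
  by (rule open_approx_App)

section \<open>Inequality testing\<close>

text \<open>The specification of \<open>neq\<close> used here speaks of terms of T + min, so
  divergence must come from \<open>min\<close>: it searches for a zero of a constant nonzero
  function.\<close>

abbreviation Omega :: tm where
  "Omega \<equiv> Const CMin \<cdot> Lam N (num 1) \<cdot> num 0"

lemma diverges_Omega: "diverges Omega"
proof -
  let ?A = "\<lambda>n. Const CMin \<cdot> Lam N (num 1) \<cdot> num n"
  \<comment> \<open>A term that visibly has no value. Since every round of the search costs a step,
    the search approximates it at every index.\<close>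
  let ?stuck = "Fst (num 0)"
  have step: "step\<^sup>+\<^sup>+ (?A n) (?A (Suc n))" for n
    \<comment> \<open>After the unfolding of \<open>min\<close>, five steps decide the test and
      evaluate the successor.\<close>
    by (rule plus_driveI[of _ _ "Suc (Suc (Suc (Suc (Suc 0))))"])
       (simp add: contract_strict_def, simp add: contract_strict_def)
  have A: "approx N k (?A n) ?stuck" for k n
  proof (induction k arbitrary: n)
    case 0
    show ?case by (rule approx_0) simp
  next
    case (Suc k)
    show ?case by (rule approx_expand_left_plus[OF step]) (use Suc in simp)
  qed
  have "\<not> ?stuck \<leadsto>\<^sup>* num n" for n
    by (auto elim: converse_rtranclpE simp: step_iff)
  with A[of _ 0] show ?thesis
    unfolding diverges_def by (meson approx_N_steps order_refl rtranclp_imp_relpowp)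
qed

lemma closed_term_Omega: "closed_term lang_T_min Omega N"
proof -
  have "[] \<turnstile> Const CMin : (N \<rightarrow> N) \<rightarrow> N \<rightarrow> N" "[] \<turnstile> num 0 : N" "[N] \<turnstile> num 1 : N"
    using typing.intros(2)[of _ CMin] typing.intros(2)[of _ "CNum k" for k] by simp_all
  then show ?thesis
    by (auto simp: closed_term_def lang_T_min_def lang_B_def intro: typing.intros(3,4))
qed

locale neq_program =
  fixes neq :: tm
  assumes closed_term_neq: "closed_term lang_T_min neq (N \<rightarrow> N \<rightarrow> N)"
    and neq: "implements_neq lang_T_min neq"
begin

lemma below_neq: "below (N \<rightarrow> N \<rightarrow> N) neq neq"
  using closed_term_neq unfolding closed_term_def
  by (blast intro: open_approx_refl below_T_min_cnst)

lemma closed_neq [simp]: "closed neq"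
  using below_neq by (simp add: below_iff)

lemma closed_term_num: "closed_term lang_T_min (num n) N"
  using typing.intros(2)[of _ "CNum n"] by (auto simp: closed_term_def lang_T_min_def lang_B_def)

text \<open>The specification is applied to the numeral \<open>q\<close>, which approximates every
  closed term with that value, typed or not.\<close>

lemma neq_value:
  assumes "closed P" "P \<leadsto>\<^sup>* num q"
  shows "\<exists>r. neq \<cdot> P \<cdot> num 0 \<leadsto>\<^sup>* num r \<and> (r = 0 \<longleftrightarrow> q \<noteq> 0)"
proof -
  have "\<exists>r. neq \<cdot> num q \<cdot> num 0 \<leadsto>\<^sup>* num r \<and> (r = 0 \<longleftrightarrow> q \<noteq> 0)"
    using neq closed_term_num[of q] closed_term_num[of 0] unfolding implements_neq_def
    by (metis rtranclp.rtrancl_refl)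
  moreover have "below N (neq \<cdot> num q \<cdot> num 0) (neq \<cdot> P \<cdot> num 0)"
    using assms approx_num_steps
    by (intro below_App[OF below_App[OF below_neq] below_num]) (simp only: below_iff, auto)
  ultimately show ?thesis using below_steps by blast
qed

text \<open>
  If \<open>P\<close> had no value within \<open>i\<close> steps, it would approximate the divergent
  \<open>Omega\<close> at index \<open>i\<close>.
\<close>

lemma neq_argument_value:
  assumes "closed P" "(step ^^ i) (neq \<cdot> P \<cdot> num 0) (num r)"
  shows "\<exists>j\<le>i. \<exists>q. (step ^^ j) P (num q)"
proof (rule ccontr)
  assume "\<not> ?thesis"
  then have P: "approx N i P Omega" by auto
  have neq: "approx (N \<rightarrow> N \<rightarrow> N) i neq neq" using below_neq by (simp add: below_iff del: approx.simps)
  have "approx N i (neq \<cdot> P \<cdot> num 0) (neq \<cdot> Omega \<cdot> num 0)"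
    by (rule approx_app[OF approx_app[OF neq _ _ P] _ _ approx_num]) (use assms in simp_all)
  then have "neq \<cdot> Omega \<cdot> num 0 \<leadsto>\<^sup>* num r"
    by (rule approx_N_steps) (use assms in simp_all)
  with neq_program_axioms show False
    using closed_term_Omega closed_term_num[of 0] diverges_Omega
    unfolding neq_program_def implements_neq_def diverges_def by blast
qed

section \<open>Loops by minimization\<close>

definition body :: "ty \<Rightarrow> tm \<Rightarrow> tm" where
  "body \<sigma> F = Lam \<sigma> (Lam N (F \<cdot> Var 1))"

definition iter :: "ty \<Rightarrow> tm \<Rightarrow> tm \<Rightarrow> tm \<Rightarrow> tm" where
  "iter \<sigma> X F P = Const (CRec \<sigma>) \<cdot> X \<cdot> body \<sigma> F \<cdot> P"

text \<open>A condition of value 0 keeps the loop running, but a test of value 0 ends the search of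
  \<open>min\<close>; comparison with 0 by \<open>neq\<close> exchanges the two.\<close>

definition exit_test :: "ty \<Rightarrow> tm \<Rightarrow> tm \<Rightarrow> tm \<Rightarrow> tm" where
  "exit_test \<sigma> C X F = Lam N (neq \<cdot> (C \<cdot> iter \<sigma> X F (Var 0)) \<cdot> num 0)"

text \<open>The loop after \<open>n\<close> rounds: the search goes on from \<open>n\<close>, while
  the initial state \<open>X\<close> is kept, because the number found is handed to an iteration
  from the start.\<close>

definition min_loop :: "ty \<Rightarrow> tm \<Rightarrow> tm \<Rightarrow> tm \<Rightarrow> nat \<Rightarrow> tm" where
  "min_loop \<sigma> C X F n = iter \<sigma> X F (Const CMin \<cdot> exit_test \<sigma> C X F \<cdot> num n)"

lemma closed_body [simp]: "closed F \<Longrightarrow> closed (body \<sigma> F)"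
  by (simp add: body_def)

lemma closed_iter [simp]: "closed X \<Longrightarrow> closed F \<Longrightarrow> closed P \<Longrightarrow> closed (iter \<sigma> X F P)"
  by (simp add: iter_def)

lemma closed_exit_test [simp]: "closed C \<Longrightarrow> closed X \<Longrightarrow> closed F \<Longrightarrow> closed (exit_test \<sigma> C X F)"
  by (simp add: exit_test_def iter_def)

lemma While_T_min_steps:
  assumes "closed C" "closed X" "closed F"
  shows "While_T_min neq \<sigma> \<cdot> C \<cdot> X \<cdot> F \<leadsto>\<^sup>* min_loop \<sigma> C X F 0"
  using assms by (intro steps_driveI[of "Suc (Suc (Suc 0))"])
    (simp add: While_T_min_def min_loop_def iter_def exit_test_def body_def)

lemma closed_While_T_min [simp]: "closed (While_T_min neq \<sigma>)"
  by (simp add: While_T_min_def)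

lemma iter_0: "iter \<sigma> X F (num 0) \<leadsto>\<^sup>* X"
  unfolding iter_def by (rule r_into_rtranclp, rule step.intros)

lemma iter_Suc: "closed X \<Longrightarrow> closed F \<Longrightarrow> iter \<sigma> X F (num (Suc n)) \<leadsto>\<^sup>* F \<cdot> iter \<sigma> X F (num n)"
  by (rule steps_driveI[of "Suc (Suc (Suc 0))"]) (simp add: iter_def body_def contract_strict_def)

lemma exit_test_step:
  "closed C \<Longrightarrow> closed X \<Longrightarrow> closed F \<Longrightarrow>
     exit_test \<sigma> C X F \<cdot> num n \<leadsto> neq \<cdot> (C \<cdot> iter \<sigma> X F (num n)) \<cdot> num 0"
  by (rule next_tm_step) (simp add: exit_test_def iter_def)

lemma strict_ctx_iter: "strict_ctx (iter \<sigma> X F)"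
  unfolding iter_def by (rule strict_ctxs)

lemma min_loop_step:
  "min_loop \<sigma> C X F n \<leadsto> iter \<sigma> X F (Const CIfzero \<cdot> (exit_test \<sigma> C X F \<cdot> num n) \<cdot> num n \<cdot>
     (Const CMin \<cdot> exit_test \<sigma> C X F \<cdot> (Const CSuc \<cdot> num n)))"
  unfolding min_loop_def by (rule strict_ctx_step[OF strict_ctx_iter]) (rule step.intros(13))

lemma min_loop_branch:
  assumes "closed C" "closed X" "closed F"
  shows "iter \<sigma> X F (Const CIfzero \<cdot> num r \<cdot> num n \<cdot>
      (Const CMin \<cdot> exit_test \<sigma> C X F \<cdot> (Const CSuc \<cdot> num n))) \<leadsto>\<^sup>*
    (if r = 0 then iter \<sigma> X F (num n) else min_loop \<sigma> C X F (Suc n))"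
proof -
  let ?M = "Const CMin \<cdot> exit_test \<sigma> C X F"
  have "Const CIfzero \<cdot> num r \<cdot> num n \<cdot> (?M \<cdot> (Const CSuc \<cdot> num n)) \<leadsto>\<^sup>*
      (if r = 0 then num n else ?M \<cdot> (Const CSuc \<cdot> num n))"
    by (rule ifzero_N_steps) (use assms in simp_all)
  also have "\<dots> \<leadsto>\<^sup>* (if r = 0 then num n else ?M \<cdot> num (Suc n))"
    using strict_ctx_step[OF strict_ctxs(5)[of "exit_test \<sigma> C X F"] step.intros(4)[of n]]
    by (auto intro: r_into_rtranclp)
  finally have "Const CIfzero \<cdot> num r \<cdot> num n \<cdot> (?M \<cdot> (Const CSuc \<cdot> num n)) \<leadsto>\<^sup>*
      (if r = 0 then num n else ?M \<cdot> num (Suc n))" .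
  from strict_ctx_steps[OF strict_ctx_iter[of \<sigma> X F] this] show ?thesis
    by (cases "r = 0") (simp_all add: min_loop_def)
qed

lemma strict_ctx_min_loop: "strict_ctx (\<lambda>M. iter \<sigma> X F (Const CIfzero \<cdot> M \<cdot> num n \<cdot> P))"
  by (rule strict_ctx_comp[OF strict_ctx_iter]) (intro strict_ctx_App strict_ctxs)

lemma min_loop_steps:
  assumes "closed C" "closed X" "closed F" "C \<cdot> iter \<sigma> X F (num n) \<leadsto>\<^sup>* num q"
  shows "min_loop \<sigma> C X F n \<leadsto>\<^sup>* (if q = 0 then min_loop \<sigma> C X F (Suc n) else iter \<sigma> X F (num n))"
proof -
  obtain r where r: "neq \<cdot> (C \<cdot> iter \<sigma> X F (num n)) \<cdot> num 0 \<leadsto>\<^sup>* num r" "r = 0 \<longleftrightarrow> q \<noteq> 0"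
    using neq_value[OF _ assms(4)] assms by auto
  have "exit_test \<sigma> C X F \<cdot> num n \<leadsto>\<^sup>* num r"
    using exit_test_step[OF assms(1-3)] r(1) by (rule converse_rtranclp_into_rtranclp)
  from converse_rtranclp_into_rtranclp[OF min_loop_step strict_ctx_steps[OF strict_ctx_min_loop this]]
  have "min_loop \<sigma> C X F n \<leadsto>\<^sup>* iter \<sigma> X F (Const CIfzero \<cdot> num r \<cdot> num n \<cdot>
      (Const CMin \<cdot> exit_test \<sigma> C X F \<cdot> (Const CSuc \<cdot> num n)))" .
  also note min_loop_branch[OF assms(1-3)]
  finally show ?thesis using r(2) by (cases "q = 0") simp_all
qed

text \<open>The invariant is that the current state of \<open>while\<close> approximates the
  \<open>n\<close>-th iterate. Recomputing that iterate in every round is free, being on the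
  right.\<close>

lemma approx_CWhile_min_loop:
  assumes "closed C" "closed F" "closed C'" "closed X'" "closed F'"
    and "approx (\<sigma> \<rightarrow> N) k C C'" "approx (\<sigma> \<rightarrow> \<sigma>) k F F'"
    and "closed Y" "approx \<sigma> k Y (iter \<sigma> X' F' (num n))"
  shows "approx \<sigma> k (Const (CWhile \<sigma>) \<cdot> C \<cdot> Y \<cdot> F) (min_loop \<sigma> C' X' F' n)"
  using assms(6-)
proof (induction k arbitrary: Y n rule: less_induct)
  case (less k)
  let ?I = "iter \<sigma> X' F' (num n)"
  note closed = assms(1-5) less.prems(3)
  show ?case
  proof (rule approx_expand_left_plus[OF CWhile_unfold], rule approx_ifzero_left)
    fix j i q assume k: "k = Suc j" and i: "i \<le> j" "(step ^^ i) (C \<cdot> Y) (num q)"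
    have "approx N k (C \<cdot> Y) (C' \<cdot> ?I)"
      by (rule approx_app) (use less.prems closed in simp_all)
    then have C': "C' \<cdot> ?I \<leadsto>\<^sup>* num q"
      by (rule approx_N_steps) (use k i in auto)
    have "approx \<sigma> (j - i) (if q = 0 then Const (CWhile \<sigma>) \<cdot> C \<cdot> (F \<cdot> Y) \<cdot> F else Y)
       (if q = 0 then min_loop \<sigma> C' X' F' (Suc n) else ?I)"
    proof (cases q)
      case 0
      have "approx \<sigma> (j - i) (Const (CWhile \<sigma>) \<cdot> C \<cdot> (F \<cdot> Y) \<cdot> F) (min_loop \<sigma> C' X' F' (Suc n))"
      proof (rule less.IH)
        have "approx \<sigma> k (F \<cdot> Y) (F' \<cdot> ?I)"
          by (rule approx_app[OF less.prems(2)]) (use less.prems closed in simp_all)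
        then have "approx \<sigma> (j - i) (F \<cdot> Y) (F' \<cdot> ?I)"
          by (rule approx_mono) (use k in simp)
        then show "approx \<sigma> (j - i) (F \<cdot> Y) (iter \<sigma> X' F' (num (Suc n)))"
          by (rule approx_expand_right[OF iter_Suc[OF assms(4,5)]])
        show "approx (\<sigma> \<rightarrow> N) (j - i) C C'" "approx (\<sigma> \<rightarrow> \<sigma>) (j - i) F F'"
          by (rule approx_mono[OF less.prems(1)] approx_mono[OF less.prems(2)]; use k in simp)+
      qed (use k closed in simp_all)
      with 0 show ?thesis by simp
    next
      case (Suc m)
      then show ?thesis using approx_mono[OF less.prems(4)] k by simp
    qed
    then show "approx \<sigma> (j - i) (if q = 0 then Const (CWhile \<sigma>) \<cdot> C \<cdot> (F \<cdot> Y) \<cdot> F else Y)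
       (min_loop \<sigma> C' X' F' n)"
      by (rule approx_expand_right[OF min_loop_steps[OF assms(3-5) C']])
  qed (use closed in auto)
qed

text \<open>The mirrored invariant, with the search as the counted side. Its condition is related to
  that of \<open>while\<close> only up to index \<open>k\<close>, so
  \<open>neq_argument_value\<close> is needed to bound the steps to its value by those of the
  test.\<close>

lemma approx_min_loop_CWhile:
  assumes "closed C" "closed X" "closed F" "closed C'" "closed F'"
    and "approx (\<sigma> \<rightarrow> N) k C C'" "approx (\<sigma> \<rightarrow> \<sigma>) k F F'"
    and "closed Y'" "approx \<sigma> k (iter \<sigma> X F (num n)) Y'"
  shows "approx \<sigma> k (min_loop \<sigma> C X F n) (Const (CWhile \<sigma>) \<cdot> C' \<cdot> Y' \<cdot> F')"
  using assms(6-)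
proof (induction k arbitrary: Y' n rule: less_induct)
  case (less k)
  let ?I = "iter \<sigma> X F (num n)"
  let ?E = "\<lambda>M. iter \<sigma> X F (Const CIfzero \<cdot> M \<cdot> num n \<cdot>
     (Const CMin \<cdot> exit_test \<sigma> C X F \<cdot> (Const CSuc \<cdot> num n)))"
  note closed = assms(1-5) less.prems(3)
  show ?case
  proof (rule approx_expand_left_plus[OF tranclp.r_into_trancl[of step, OF min_loop_step]],
      rule approx_bind[OF strict_ctx_min_loop])
    fix j i r assume k: "k = Suc j" and i: "i \<le> j" "(step ^^ i) (exit_test \<sigma> C X F \<cdot> num n) (num r)"
    \<comment> \<open>The application of \<open>exit_test\<close> is not a numeral, so the first of
      the \<open>i\<close> steps is its beta step.\<close>
    obtain i' where i': "i = Suc i'" "(step ^^ i') (neq \<cdot> (C \<cdot> ?I) \<cdot> num 0) (num r)"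
    proof (cases i)
      case 0
      with i show ?thesis by simp
    next
      case (Suc i')
      from relpowp_Suc_D2[OF i(2)[unfolded Suc]] exit_test_step[OF assms(1-3)] that Suc
      show ?thesis by (metis step_deterministic)
    qed
    then obtain l q where l: "l \<le> i'" "(step ^^ l) (C \<cdot> ?I) (num q)"
      using neq_argument_value[of "C \<cdot> ?I"] closed by fastforce
    have "approx N k (C \<cdot> ?I) (C' \<cdot> Y')"
      by (rule approx_app) (use less.prems closed in simp_all)
    then have C': "C' \<cdot> Y' \<leadsto>\<^sup>* num q"
      by (rule approx_N_steps) (use k i l i' in auto)
    \<comment> \<open>\<open>neq_value\<close> provides some value with this property, and by
      determinism it is \<open>r\<close>.\<close>
    have rq: "r = 0 \<longleftrightarrow> q \<noteq> 0"
      using neq_value[OF _ relpowp_imp_rtranclp[OF l(2)]] steps_num_unique[OF relpowp_imp_rtranclp[OF i'(2)]]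
        closed by auto
    have "approx \<sigma> (j - i) (if r = 0 then ?I else min_loop \<sigma> C X F (Suc n))
        (if q = 0 then Const (CWhile \<sigma>) \<cdot> C' \<cdot> (F' \<cdot> Y') \<cdot> F' else Y')"
    proof (cases q)
      case 0
      have "approx \<sigma> (j - i) (min_loop \<sigma> C X F (Suc n)) (Const (CWhile \<sigma>) \<cdot> C' \<cdot> (F' \<cdot> Y') \<cdot> F')"
      proof (rule less.IH)
        have "approx \<sigma> k (F \<cdot> ?I) (F' \<cdot> Y')"
          by (rule approx_app[OF less.prems(2)]) (use less.prems closed in simp_all)
        then have "approx \<sigma> (j - i) (F \<cdot> ?I) (F' \<cdot> Y')"
          by (rule approx_mono) (use k in simp)
        then show "approx \<sigma> (j - i) (iter \<sigma> X F (num (Suc n))) (F' \<cdot> Y')"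
          by (rule approx_expand_left[OF iter_Suc[OF assms(2,3)]])
        show "approx (\<sigma> \<rightarrow> N) (j - i) C C'" "approx (\<sigma> \<rightarrow> \<sigma>) (j - i) F F'"
          by (rule approx_mono[OF less.prems(1)] approx_mono[OF less.prems(2)]; use k in simp)+
      qed (use k closed in simp_all)
      with 0 rq show ?thesis by simp
    next
      case (Suc m)
      then show ?thesis using approx_mono[OF less.prems(4)] k rq by simp
    qed
    then have "approx \<sigma> (j - i) (?E (num r))
        (if q = 0 then Const (CWhile \<sigma>) \<cdot> C' \<cdot> (F' \<cdot> Y') \<cdot> F' else Y')"
      by (rule approx_expand_left[OF min_loop_branch[OF assms(1-3)]])
    then have "approx \<sigma> (j - i) (?E (num r))
        (ifzero \<sigma> \<cdot> (C' \<cdot> Y') \<cdot> (Const (CWhile \<sigma>) \<cdot> C' \<cdot> (F' \<cdot> Y') \<cdot> F') \<cdot> Y')"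
      by (intro approx_ifzero_right[OF _ _ _ C']) (use closed in simp_all)
    then show "approx \<sigma> (j - i) (?E (num r)) (Const (CWhile \<sigma>) \<cdot> C' \<cdot> Y' \<cdot> F')"
      by (rule approx_expand_right[OF tranclp_into_rtranclp[OF CWhile_unfold]])
  qed
qed

lemma below_CWhile_While_T_min: "below (while_ty \<sigma>) (Const (CWhile \<sigma>)) (While_T_min neq \<sigma>)"
proof (rule below_Fun3I)
  fix k C C' X X' F F'
  assume *: "closed C" "closed C'" "closed X" "closed X'" "closed F" "closed F'"
    "approx (\<sigma> \<rightarrow> N) k C C'" "approx \<sigma> k X X'" "approx (\<sigma> \<rightarrow> \<sigma>) k F F'"
  have "approx \<sigma> k (Const (CWhile \<sigma>) \<cdot> C \<cdot> X \<cdot> F) (min_loop \<sigma> C' X' F' 0)"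
    by (rule approx_CWhile_min_loop[OF *(1,5,2,4,6,7,9,3)]) (rule approx_expand_right[OF iter_0 *(8)])
  then show "approx \<sigma> k (Const (CWhile \<sigma>) \<cdot> C \<cdot> X \<cdot> F) (While_T_min neq \<sigma> \<cdot> C' \<cdot> X' \<cdot> F')"
    by (rule approx_expand_right[OF While_T_min_steps[OF *(2,4,6)]])
qed simp_all

lemma below_While_T_min_CWhile: "below (while_ty \<sigma>) (While_T_min neq \<sigma>) (Const (CWhile \<sigma>))"
proof (rule below_Fun3I)
  fix k C C' X X' F F'
  assume *: "closed C" "closed C'" "closed X" "closed X'" "closed F" "closed F'"
    "approx (\<sigma> \<rightarrow> N) k C C'" "approx \<sigma> k X X'" "approx (\<sigma> \<rightarrow> \<sigma>) k F F'"
  have "approx \<sigma> k (min_loop \<sigma> C X F 0) (Const (CWhile \<sigma>) \<cdot> C' \<cdot> X' \<cdot> F')"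
    by (rule approx_min_loop_CWhile[OF *(1,3,5,2,6,7,9,4)]) (rule approx_expand_left[OF iter_0 *(8)])
  then show "approx \<sigma> k (While_T_min neq \<sigma> \<cdot> C \<cdot> X \<cdot> F) (Const (CWhile \<sigma>) \<cdot> C' \<cdot> X' \<cdot> F')"
    by (rule approx_expand_left[OF While_T_min_steps[OF *(1,3,5)]])
qed simp_all

end

section \<open>Type inference\<close>

text \<open>A typing algorithm, so that the types of the concrete programs come out by
  simplification.\<close>

primrec infer :: "ty list \<Rightarrow> tm \<Rightarrow> ty option" where
  "infer \<Gamma> (Var i) = (if i < length \<Gamma> then Some (\<Gamma> ! i) else None)"
| "infer \<Gamma> (Const c) = Some (cnst_ty c)"
| "infer \<Gamma> (Lam \<sigma> M) = map_option (Fun \<sigma>) (infer (\<sigma> # \<Gamma>) M)"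
| "infer \<Gamma> (M \<cdot> P) = (case infer \<Gamma> M of
     Some (\<sigma> \<rightarrow> \<tau>) \<Rightarrow> if infer \<Gamma> P = Some \<sigma> then Some \<tau> else None
   | _ \<Rightarrow> None)"
| "infer \<Gamma> (Pair M P) = (case infer \<Gamma> M of
     Some \<sigma> \<Rightarrow> map_option (Prod \<sigma>) (infer \<Gamma> P)
   | None \<Rightarrow> None)"
| "infer \<Gamma> (Fst M) = (case infer \<Gamma> M of Some (\<sigma> \<otimes> \<tau>) \<Rightarrow> Some \<sigma> | _ \<Rightarrow> None)"
| "infer \<Gamma> (Snd M) = (case infer \<Gamma> M of Some (\<sigma> \<otimes> \<tau>) \<Rightarrow> Some \<tau> | _ \<Rightarrow> None)"

lemma infer_typing: "infer \<Gamma> M = Some \<tau> \<Longrightarrow> \<Gamma> \<turnstile> M : \<tau>"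
proof (induction M arbitrary: \<Gamma> \<tau>)
  case (App M P)
  then obtain \<sigma> where "infer \<Gamma> M = Some (\<sigma> \<rightarrow> \<tau>)" "infer \<Gamma> P = Some \<sigma>"
    by (auto split: if_splits option.splits ty.splits)
  with App.IH show ?case by (blast intro: typing.intros(4))
qed (auto split: if_splits option.splits ty.splits intro: typing.intros)

text \<open>Weakening is built in, since a closed program such as \<open>neq\<close> is used under
  binders.\<close>

lemma typing_infer: "\<Gamma> \<turnstile> M : \<tau> \<Longrightarrow> infer (\<Gamma> @ \<Delta>) M = Some \<tau>"
  by (induction rule: typing.induct) (auto simp: nth_append)

lemma infer_ifzero [simp]: "infer \<Gamma> (ifzero \<sigma>) = Some (N \<rightarrow> \<sigma> \<rightarrow> \<sigma> \<rightarrow> \<sigma>)"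
  by (induction \<sigma> arbitrary: \<Gamma>) auto

lemma infer_replace:
  "\<Gamma> \<turnstile> M : \<tau> \<Longrightarrow> (\<And>\<Gamma> c. c \<in> cnsts_of M \<Longrightarrow> infer \<Gamma> (h c) = Some (cnst_ty c)) \<Longrightarrow>
     infer \<Gamma> (replace h M) = Some \<tau>"
  by (induction rule: typing.induct) auto

lemma cnsts_of_replace: "cnsts_of (replace h M) = (\<Union>c\<in>cnsts_of M. cnsts_of (h c))"
  by (induction M) auto

lemma cnsts_of_ifzero: "cnsts_of (ifzero \<sigma>) \<subseteq> lang_B"
  by (induction \<sigma>) (auto simp: lang_B_def)

lemma closed_term_replace:
  assumes "closed_term L M \<tau>"
    and "\<And>\<Gamma> c. c \<in> L \<Longrightarrow> infer \<Gamma> (h c) = Some (cnst_ty c) \<and> cnsts_of (h c) \<subseteq> L'"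
  shows "closed_term L' (replace h M) \<tau>"
  using assms infer_typing[OF infer_replace[of "[]" M \<tau> h]]
  by (fastforce simp: closed_term_def cnsts_of_replace)

lemma infer_While_PCF: "infer \<Gamma> (While_PCF \<sigma>) = Some (while_ty \<sigma>)"
  by (simp add: While_PCF_def)

lemma infer_Rec_PCF: "infer \<Gamma> (Rec_PCF \<sigma>) = Some (rec_ty \<sigma>)"
  by (simp add: Rec_PCF_def)

lemma infer_Min_PCF: "infer \<Gamma> Min_PCF = Some min_ty"
  by (simp add: Min_PCF_def)

lemma lang_B_subset: "lang_B \<subseteq> lang_PCF_byval" "lang_B \<subseteq> lang_T_min"
  by (auto simp: lang_PCF_byval_def lang_T_min_def)

lemma cnsts_of_While_PCF: "cnsts_of (While_PCF \<sigma>) \<subseteq> lang_PCF_byval"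
  using cnsts_of_ifzero[of \<sigma>] by (auto simp: While_PCF_def lang_PCF_byval_def)

lemma cnsts_of_Rec_PCF: "cnsts_of (Rec_PCF \<sigma>) \<subseteq> lang_PCF_byval"
  using cnsts_of_ifzero[of \<sigma>] by (auto simp: Rec_PCF_def lang_PCF_byval_def lang_B_def)

lemma cnsts_of_Min_PCF: "cnsts_of Min_PCF \<subseteq> lang_PCF_byval"
  by (auto simp: Min_PCF_def lang_PCF_byval_def lang_B_def)

section \<open>Terms, their translations and observational equivalence\<close>

abbreviation PCF_of_cnst :: "cnst \<Rightarrow> tm" where
  "PCF_of_cnst \<equiv> \<lambda>c. case c of
     CWhile \<sigma> \<Rightarrow> While_PCF \<sigma>
   | CRec \<sigma> \<Rightarrow> Rec_PCF \<sigma>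
   | CMin \<Rightarrow> Min_PCF
   | _ \<Rightarrow> Const c"

lemma closed_term_to_PCF:
  assumes "closed_term L M \<tau>" "L \<subseteq> lang_W \<union> lang_T_min"
  shows "closed_term lang_PCF_byval (to_PCF M) \<tau>"
  unfolding to_PCF_def
proof (rule closed_term_replace[OF assms(1)])
  fix \<Gamma> c assume "c \<in> L"
  with assms(2) have "c \<in> lang_W \<union> lang_T_min" by blast
  then show "infer \<Gamma> (PCF_of_cnst c) = Some (cnst_ty c) \<and> cnsts_of (PCF_of_cnst c) \<subseteq> lang_PCF_byval"
    using cnsts_of_While_PCF[THEN subsetD] cnsts_of_Rec_PCF[THEN subsetD]
      cnsts_of_Min_PCF lang_B_subset(1)
    by (auto simp: lang_W_def lang_T_min_def lang_B_def infer_While_PCF infer_Rec_PCF infer_Min_PCF)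
qed

lemma below_PCF_of_cnst:
  assumes "c \<in> lang_W \<union> lang_T_min"
  shows "below (cnst_ty c) (Const c) (PCF_of_cnst c)" "below (cnst_ty c) (PCF_of_cnst c) (Const c)"
  using assms below_T_min_cnst[of c] below_CWhile_While_PCF below_While_PCF_CWhile
    below_implements_rec[OF implements_rec_CRec implements_rec_Rec_PCF]
    below_implements_rec[OF implements_rec_Rec_PCF implements_rec_CRec]
    below_implements_min[OF implements_min_CMin implements_min_Min_PCF]
    below_implements_min[OF implements_min_Min_PCF implements_min_CMin]
  by (auto simp: lang_W_def lang_T_min_def lang_B_def)

definition equiv_tm :: "ty \<Rightarrow> tm \<Rightarrow> tm \<Rightarrow> bool" where
  "equiv_tm \<sigma> M M' \<longleftrightarrow> below \<sigma> M M' \<and> below \<sigma> M' M"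

lemma equiv_tm_sym: "equiv_tm \<sigma> M M' \<Longrightarrow> equiv_tm \<sigma> M' M"
  by (simp add: equiv_tm_def)

lemma equiv_tm_replace:
  assumes "closed_term L M \<tau>"
    and "\<And>c. c \<in> L \<Longrightarrow> below (cnst_ty c) (Const c) (h c) \<and> below (cnst_ty c) (h c) (Const c)"
  shows "equiv_tm \<tau> M (replace h M)"
  using assms open_approx_replace[of "[]" M \<tau> Const h] open_approx_replace[of "[]" M \<tau> h Const]
  unfolding equiv_tm_def closed_term_def replace_Const by blast

lemma equiv_tm_to_PCF:
  "closed_term L M \<tau> \<Longrightarrow> L \<subseteq> lang_W \<union> lang_T_min \<Longrightarrow> equiv_tm \<tau> M (to_PCF M)"
  unfolding to_PCF_def using below_PCF_of_cnst by (intro equiv_tm_replace) blast+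

lemma equiv_tm_steps: "equiv_tm N M M' \<Longrightarrow> M \<leadsto>\<^sup>* num n \<longleftrightarrow> M' \<leadsto>\<^sup>* num n"
  unfolding equiv_tm_def using below_steps by blast

lemma equiv_tm_fill:
  assumes "equiv_tm \<sigma> M M'" "ctx_cnsts_of C \<subseteq> lang_PCF_byval" "ctx_typing \<sigma> [] C N"
  shows "fill C M \<leadsto>\<^sup>* num n \<longleftrightarrow> fill C M' \<leadsto>\<^sup>* num n"
proof (rule equiv_tm_steps)
  show "equiv_tm N (fill C M) (fill C M')"
    using assms below_PCF_cnst unfolding equiv_tm_def by (blast intro: open_approx_fill)
qed

text \<open>The links are composed inside each context, on numerals. The two middle terms may lie
  outside PCF + byval: only the ends have to be in that language, and a context can be filled with
  any term.\<close>

lemma obs_eq_chain: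
  assumes "closed_term lang_PCF_byval M1 \<sigma>" "closed_term lang_PCF_byval M4 \<sigma>"
    and "equiv_tm \<sigma> M1 M2" "equiv_tm \<sigma> M2 M3" "equiv_tm \<sigma> M3 M4"
  shows "obs_eq \<sigma> M1 M4"
  using assms(1,2) equiv_tm_fill[OF assms(3)] equiv_tm_fill[OF assms(4)] equiv_tm_fill[OF assms(5)]
  unfolding obs_eq_def by blast

context neq_program
begin

lemma infer_neq: "infer \<Gamma> neq = Some (N \<rightarrow> N \<rightarrow> N)"
  using typing_infer[of "[]" neq _ \<Gamma>] closed_term_neq by (simp add: closed_term_def)

lemma infer_While_T_min: "infer \<Gamma> (While_T_min neq \<sigma>) = Some (while_ty \<sigma>)"
  by (simp add: While_T_min_def infer_neq)

lemma cnsts_of_While_T_min: "cnsts_of (While_T_min neq \<sigma>) \<subseteq> lang_T_min"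
  using closed_term_neq by (auto simp: closed_term_def While_T_min_def lang_T_min_def lang_B_def)

lemma closed_term_While_T_min: "closed_term lang_T_min (While_T_min neq \<sigma>) (while_ty \<sigma>)"
  using infer_typing[OF infer_While_T_min] cnsts_of_While_T_min by (simp add: closed_term_def)

lemma closed_term_to_T_min: "closed_term lang_W M \<tau> \<Longrightarrow> closed_term lang_T_min (to_T_min neq M) \<tau>"
  unfolding to_T_min_def using lang_B_subset(2) cnsts_of_While_T_min[THEN subsetD]
  by (elim closed_term_replace) (auto simp: lang_W_def lang_B_def infer_While_T_min)

text \<open>At type \<open>N\<close> this already yields the agreement of values between W and T +
  min, without passing through PCF.\<close>

lemma equiv_tm_to_T_min: "closed_term lang_W M \<tau> \<Longrightarrow> equiv_tm \<tau> M (to_T_min neq M)"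
  unfolding to_T_min_def
  using below_num below_CSuc below_CPre below_CIfzero
    below_CWhile_While_T_min below_While_T_min_CWhile
  by (elim equiv_tm_replace) (auto simp: lang_W_def lang_B_def)

text \<open>The loop by minimization and the loop by fixed point are never compared directly; both
  are compared with the constant \<open>while\<close>.\<close>

lemma obs_eq_While: "obs_eq (while_ty \<sigma>) (to_PCF (While_T_min neq \<sigma>)) (While_PCF \<sigma>)"
proof (rule obs_eq_chain)
  show "closed_term lang_PCF_byval (to_PCF (While_T_min neq \<sigma>)) (while_ty \<sigma>)"
    using closed_term_While_T_min by (rule closed_term_to_PCF) blast
  show "closed_term lang_PCF_byval (While_PCF \<sigma>) (while_ty \<sigma>)"
    using infer_typing[OF infer_While_PCF] cnsts_of_While_PCF by (simp add: closed_term_def)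
  show "equiv_tm (while_ty \<sigma>) (to_PCF (While_T_min neq \<sigma>)) (While_T_min neq \<sigma>)"
    using closed_term_While_T_min by (rule equiv_tm_sym[OF equiv_tm_to_PCF]) blast
  show "equiv_tm (while_ty \<sigma>) (While_T_min neq \<sigma>) (Const (CWhile \<sigma>))"
    using below_CWhile_While_T_min below_While_T_min_CWhile by (simp add: equiv_tm_def)
  show "equiv_tm (while_ty \<sigma>) (Const (CWhile \<sigma>)) (While_PCF \<sigma>)"
    using below_CWhile_While_PCF below_While_PCF_CWhile by (simp add: equiv_tm_def)
qed

lemma obs_eq_to_T_min:
  assumes "closed_term lang_W M \<sigma>"
  shows "obs_eq \<sigma> (to_PCF (to_T_min neq M)) (to_PCF M)"
proof (rule obs_eq_chain)
  note T = closed_term_to_T_min[OF assms]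
  show "closed_term lang_PCF_byval (to_PCF (to_T_min neq M)) \<sigma>"
    using T by (rule closed_term_to_PCF) blast
  show "closed_term lang_PCF_byval (to_PCF M) \<sigma>"
    using assms by (rule closed_term_to_PCF) blast
  show "equiv_tm \<sigma> (to_PCF (to_T_min neq M)) (to_T_min neq M)"
    using T by (rule equiv_tm_sym[OF equiv_tm_to_PCF]) blast
  show "equiv_tm \<sigma> (to_T_min neq M) M"
    by (rule equiv_tm_sym[OF equiv_tm_to_T_min[OF assms]])
  show "equiv_tm \<sigma> M (to_PCF M)"
    using assms by (rule equiv_tm_to_PCF) blast
qed

end

theorem proposition4:
  fixes neq :: tm
  assumes "closed_term lang_T_min neq (N \<rightarrow> N \<rightarrow> N)"
    and "implements_neq lang_T_min neq"
    and "implements_neq lang_PCF_byval (to_PCF neq)"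
  shows "(\<forall>\<sigma>. obs_eq (while_ty \<sigma>) (to_PCF (While_T_min neq \<sigma>)) (While_PCF \<sigma>)) \<and>
         (\<forall>M \<sigma>. closed_term lang_W M \<sigma> \<longrightarrow>
            obs_eq \<sigma> (to_PCF (to_T_min neq M)) (to_PCF M)) \<and>
         (\<forall>M n. closed_term lang_W M N \<longrightarrow>
            (M \<leadsto>\<^sup>* num n \<longleftrightarrow> to_T_min neq M \<leadsto>\<^sup>* num n))"
proof -
  interpret neq_program neq
    using assms by unfold_locales
  show ?thesis
    using obs_eq_While obs_eq_to_T_min equiv_tm_steps[OF equiv_tm_to_T_min] by blast
qed

end
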